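(* Let $\Gamma$ be a finite connected graph, $\rho$ a (flat unitary complex) line bundle on $\Gamma$ with $H_0(\Gamma;\rho)=0$, and $r\colon \Gamma_1\to\mathbb{R}_{+}$ a resistance function with resistance operator $R$. Given a vector $\mathbf V\in C_1(\Gamma;\rho)$, there is one and only one vector $z\in Z_1(\Gamma;\rho)$ such that $\mathbf V-Rz\in B^1(\Gamma;\rho)$. Furthermore, for each edge $b\in\Gamma_1$, $$\langle z,b\rangle=\frac{1}{\Delta}\sum_T\frac{w_T}{r_b}\,\langle\mathbf V,\bar T(b)\rangle ,$$ where $T$ ranges over the $\rho$-spanning trees of $\Gamma$ and $\Delta=\sum_T w_T$.
   Context: Graphs. A graph $\Gamma$ is a one-dimensional CW complex with vertex set $\Gamma_0$ and edge set $\Gamma_1$; it is given by a map $(d_0,d_1)\colon\Gamma_1\to\Gamma_0\times\Gamma_0$ sending an (oriented) edge to its initial and terminal endpoints. Loop edges ($d_0(b)=d_1(b)$) and multiple edges are allowed. For a subcomplex $A\subset\Gamma$, $A_0,A_1$ denote its vertices and edges. A circuit is a simple closed path (a loop edge, or two parallel edges, may form a circuit). Line bundle and holonomy. After choosing unit vectors in the fibers, a (flat unitary complex) line bundle $\rho$ on $\Gamma$ is a function $\Gamma_1\to U(1)$, $b\mapsto\rho_b$. For an oriented circuit $C$, the holonomy is $\rho_C=\prod_{b\in C_1}\rho_b^{s_b}$, where $s_b=1$ if the orientation of $b$ agrees with that of $C$ and $s_b=-1$ otherwise. Write $z^*$ for the complex conjugate of $z\in\mathbb{C}$. If $A\subset\Gamma$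 is a subgraph each of whose connected components $A_\alpha$ has Euler characteristic zero, then each $A_\alpha$ has a unique circuit $C_\alpha$; orienting these arbitrarily, set $\hat\rho_A=\prod_\alpha(\rho_{C_\alpha}-1)(\rho_{C_\alpha}^*-1)$, a real number independent of the orientations. Twisted chains. $C_i(\Gamma;\rho)$ ($i=0,1$) is the complex vector space with basis $\Gamma_i$, and $\partial\colon C_1(\Gamma;\rho)\to C_0(\Gamma;\rho)$ is the linear map with $\partial b=\rho_b\,d_0(b)-d_1(b)$. $H_*(\Gamma;\rho)$ is the homology of this complex, so $H_1(\Gamma;\rho)=Z_1(\Gamma;\rho)=\ker\partial\subset C_1(\Gamma;\rho)$ and $H_0(\Gamma;\rho)=\operatorname{coker}\partial$. The same definitions apply to subcomplexes of $\Gamma$, with $\rho$ restricted. Inner product and resistance. On $C_1(\Gamma;\rho)$ the standard Hermitian inner product (linear in the first variable, conjugate-linear in the second) is given on edges by $\langle b,b'\rangle=\delta_{bb'}$. $B^1(\Gamma;\rho)$ is the orthogonal complement of $Z_1(\Gamma;\rho)$ in $C_1(\Gamma;\rho)$ for the standard inner product. For a resistance function $r$, $b\mapsto r_b>0$, the resistance operator $R\colon C_1(\Gamma;\rho)\to C_1(\Gamma;\rho)$ is the linear map $b\mapsto r_b b$. $\rho$-spanning trees. A $\rho$-spanning tree is a subcomplex $T\subset\Gamma$ with $T_0=\Gamma_0$, $H_1(T;\rho)=0$, and such that the inclusion induces an isomorphism $H_0(T;\rho)\to H_0(\Gamma;\rho)$. (Under the assumption $H_0(\Gamma;\rho)=0$,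 every component of a $\rho$-spanning tree has Euler characteristic zero, so $\hat\rho_T$ is defined.) The weight of $T$ is $w_T=\hat\rho_T\prod_{b\in T_1}r_b^{-1}$. The operator $\bar T\colon C_1(\Gamma;\rho)\to H_1(\Gamma;\rho)$ is the linear map defined as follows: $\bar T(b)=0$ if $b\in T_1$; if $b\in\Gamma_1\setminus T_1$, then $H_1(T\cup b;\rho)$ is one-dimensional, and for any nonzero $c$ in it, $\bar T(b)=c/t_b$ where $t_b=\langle c,b\rangle$ (independent of the choice of $c$), regarded in $H_1(\Gamma;\rho)\supset H_1(T\cup b;\rho)$. *)

theory Defs
  imports
    Complex_Main
    "HOL-Library.Function_Algebras"
    "Graph_Theory.Digraph_Component"
begin

text \<open>
  Graphs are multidigraphs with loops; \<open>tail\<close> and \<open>head\<close> are the endpoint maps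
  \<open>d\<^sub>0\<close> and \<open>d\<^sub>1\<close>. Subcomplexes are subgraphs (\<^const>\<open>subgraph\<close>); as these share the
  endpoint maps of the ambient graph, a subcomplex is determined by its vertex and edge sets.
  Connectedness (\<^const>\<open>Digraph_Component.connected\<close>) ignores edge orientations and includes
  nonemptiness.
\<close>

definition line_bundle :: "('v, 'e) pre_digraph \<Rightarrow> ('e \<Rightarrow> complex) \<Rightarrow> bool" where
  "line_bundle G \<rho> \<longleftrightarrow> (\<forall>b \<in> arcs G. cmod (\<rho> b) = 1)"


section \<open>Twisted chains and homology\<close>

text \<open>
  Chains on \<open>A\<close> are functions vanishing off the cells of \<open>A\<close>, so that the chains of a
  subcomplex literally form a subspace of the chains of the whole graph.
\<close>

definition C0 :: "('v, 'e) pre_digraph \<Rightarrow> ('v \<Rightarrow> complex) set" where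
  "C0 A = {x. \<forall>v. v \<notin> verts A \<longrightarrow> x v = 0}"

definition C1 :: "('v, 'e) pre_digraph \<Rightarrow> ('e \<Rightarrow> complex) set" where
  "C1 A = {x. \<forall>b. b \<notin> arcs A \<longrightarrow> x b = 0}"

definition cell :: "'c \<Rightarrow> 'c \<Rightarrow> complex" where
  "cell c = (\<lambda>c'. if c' = c then 1 else 0)"

definition bdry :: "('v, 'e) pre_digraph \<Rightarrow> ('e \<Rightarrow> complex) \<Rightarrow> ('e \<Rightarrow> complex) \<Rightarrow> 'v \<Rightarrow> complex" where
  "bdry A \<rho> x = (\<lambda>v. \<Sum>b \<in> arcs A. x b * (\<rho> b * cell (tail A b) v - cell (head A b) v))"

definition Z1 :: "('v, 'e) pre_digraph \<Rightarrow> ('e \<Rightarrow> complex) \<Rightarrow> ('e \<Rightarrow> complex) set" where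
  "Z1 A \<rho> = {x \<in> C1 A. bdry A \<rho> x = 0}"

abbreviation H1 :: "('v, 'e) pre_digraph \<Rightarrow> ('e \<Rightarrow> complex) \<Rightarrow> ('e \<Rightarrow> complex) set" where
  "H1 \<equiv> Z1"

definition homologous :: "('v, 'e) pre_digraph \<Rightarrow> ('e \<Rightarrow> complex) \<Rightarrow> ('v \<Rightarrow> complex) rel" where
  "homologous A \<rho> = {(x, y). x \<in> C0 A \<and> y \<in> C0 A \<and> x - y \<in> bdry A \<rho> ` C1 A}"

definition H0 :: "('v, 'e) pre_digraph \<Rightarrow> ('e \<Rightarrow> complex) \<Rightarrow> ('v \<Rightarrow> complex) set set" where
  "H0 A \<rho> = C0 A // homologous A \<rho>"

definition H0_vanishes :: "('v, 'e) pre_digraph \<Rightarrow> ('e \<Rightarrow> complex) \<Rightarrow> bool" where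
  "H0_vanishes A \<rho> \<longleftrightarrow> H0 A \<rho> = {homologous A \<rho> `` {0}}"

text \<open>The map on \<^const>\<open>H0\<close> induced by the inclusion of a subgraph into \<open>G\<close>, sending
  the class of \<open>x\<close> to the class of \<open>x\<close> in \<open>G\<close> (lemma \<open>H0_incl_class\<close> below). It is linear, so it
  is an isomorphism of vector spaces iff it is bijective.\<close>

definition H0_incl ::
    "('v, 'e) pre_digraph \<Rightarrow> ('e \<Rightarrow> complex) \<Rightarrow> ('v \<Rightarrow> complex) set \<Rightarrow> ('v \<Rightarrow> complex) set" where
  "H0_incl G \<rho> X = homologous G \<rho> `` X"

lemma bdry_add: "bdry A \<rho> (x + y) = bdry A \<rho> x + bdry A \<rho> y"
  by (simp add: bdry_def fun_eq_iff distrib_right sum.distrib)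

lemma bdry_minus: "bdry A \<rho> (- x) = - bdry A \<rho> x"
  by (simp add: bdry_def fun_eq_iff sum_negf)

lemma equiv_homologous: "equiv (C0 A) (homologous A \<rho>)"
proof (rule equivI)
  show "homologous A \<rho> \<subseteq> C0 A \<times> C0 A"
    by (auto simp: homologous_def)
  have "bdry A \<rho> 0 = 0" "0 \<in> C1 A"
    by (auto simp: bdry_def C1_def fun_eq_iff)
  then show "refl_on (C0 A) (homologous A \<rho>)"
    unfolding refl_on_def homologous_def by (auto intro: image_eqI[of _ _ 0])
  show "sym (homologous A \<rho>)"
  proof (rule symI)
    fix x y assume "(x, y) \<in> homologous A \<rho>"
    then obtain c where c: "x \<in> C0 A" "y \<in> C0 A" "c \<in> C1 A" "x - y = bdry A \<rho> c"
      by (auto simp: homologous_def)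
    then have "- c \<in> C1 A" "y - x = bdry A \<rho> (- c)"
      by (auto simp: C1_def bdry_minus simp flip: c(4))
    with c show "(y, x) \<in> homologous A \<rho>"
      by (auto simp: homologous_def)
  qed
  show "trans (homologous A \<rho>)"
  proof (rule transI)
    fix x y z assume "(x, y) \<in> homologous A \<rho>" "(y, z) \<in> homologous A \<rho>"
    then obtain c d where c: "x \<in> C0 A" "z \<in> C0 A" "c \<in> C1 A" "d \<in> C1 A"
        "x - y = bdry A \<rho> c" "y - z = bdry A \<rho> d"
      by (auto simp: homologous_def)
    then have "c + d \<in> C1 A" "x - z = bdry A \<rho> (c + d)"
      by (auto simp: C1_def bdry_add simp flip: c(5,6))
    with c show "(x, z) \<in> homologous A \<rho>"
      by (auto simp: homologous_def)
  qed
qed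

lemma bdry_subgraph:
  assumes "subgraph T G" "finite (arcs G)" "x \<in> C1 T"
  shows "bdry G \<rho> x = bdry T \<rho> x"
proof
  fix v
  have "(\<Sum>b \<in> arcs T. x b * (\<rho> b * cell (tail T b) v - cell (head T b) v)) =
      (\<Sum>b \<in> arcs G. x b * (\<rho> b * cell (tail G b) v - cell (head G b) v))"
    using assms by (intro sum.mono_neutral_cong_left) (auto simp: subgraph_def compatible_def C1_def)
  then show "bdry G \<rho> x v = bdry T \<rho> x v"
    by (simp add: bdry_def)
qed

lemma H0_incl_class:
  assumes "subgraph T G" "finite (arcs G)" "x \<in> C0 T"
  shows "H0_incl G \<rho> (homologous T \<rho> `` {x}) = homologous G \<rho> `` {x}"
proof -
  have "homologous T \<rho> \<subseteq> homologous G \<rho>"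
  proof
    fix p assume "p \<in> homologous T \<rho>"
    then obtain y z c where p: "p = (y, z)" "y \<in> C0 T" "z \<in> C0 T" "c \<in> C1 T" "y - z = bdry T \<rho> c"
      by (auto simp: homologous_def)
    have "C0 T \<subseteq> C0 G" "C1 T \<subseteq> C1 G"
      using assms(1) by (auto simp: subgraph_def C0_def C1_def)
    moreover have "y - z = bdry G \<rho> c"
      using bdry_subgraph[OF assms(1,2) p(4)] p(5) by simp
    ultimately show "p \<in> homologous G \<rho>"
      using p(1-4) unfolding homologous_def by blast
  qed
  moreover have "(x, x) \<in> homologous T \<rho>"
    using equivE[OF equiv_homologous[of T \<rho>]] assms(3) by (metis refl_onD)
  moreover have "trans (homologous G \<rho>)"
    using equivE[OF equiv_homologous[of G \<rho>]] by metis
  ultimately show ?thesis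
    unfolding H0_incl_def Image_def by (blast dest: transD)
qed


section \<open>Circuits and holonomy\<close>

text \<open>
  Oriented edges are pairs \<open>(b, s)\<close>, with \<open>s = False\<close> for \<open>b\<close> traversed against its
  orientation.
\<close>

definition oriented_edges :: "('v, 'e) pre_digraph \<Rightarrow> ('v, 'e \<times> bool) pre_digraph" where
  "oriented_edges A = \<lparr>verts = verts A, arcs = arcs A \<times> UNIV,
     tail = (\<lambda>(b, s). if s then tail A b else head A b),
     head = (\<lambda>(b, s). if s then head A b else tail A b)\<rparr>"

text \<open>
  The condition on the underlying edges only excludes \<open>[(b, s), (b, \<not> s)]\<close>, which
  is a cycle of the digraph of oriented edges but not a circuit.
\<close>

definition oriented_circuit :: "('v, 'e) pre_digraph \<Rightarrow> ('e \<times> bool) list \<Rightarrow> bool" where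
  "oriented_circuit A p \<longleftrightarrow> pre_digraph.cycle (oriented_edges A) p \<and> distinct (map fst p)"

definition holonomy :: "('e \<Rightarrow> complex) \<Rightarrow> ('e \<times> bool) list \<Rightarrow> complex" where
  "holonomy \<rho> p = (\<Prod>(b, s) \<leftarrow> p. \<rho> b powi (if s then 1 else - 1))"

definition components :: "('v, 'e) pre_digraph \<Rightarrow> ('v, 'e) pre_digraph set" where
  "components A = {H. pre_digraph.max_subgraph A Digraph_Component.connected H}"

text \<open>
  Intended for \<open>A\<close> all of whose components have Euler characteristic zero, so that each
  component has exactly one circuit, with two orientations giving the same factor.
\<close>

definition rho_hat :: "('v, 'e) pre_digraph \<Rightarrow> ('e \<Rightarrow> complex) \<Rightarrow> complex" where
  "rho_hat A \<rho> = (\<Prod>H \<in> components A.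
     let p = (SOME p. oriented_circuit H p)
     in (holonomy \<rho> p - 1) * (cnj (holonomy \<rho> p) - 1))"


section \<open>Spanning trees of a line bundle\<close>

definition rho_spanning_tree ::
    "('v, 'e) pre_digraph \<Rightarrow> ('e \<Rightarrow> complex) \<Rightarrow> ('v, 'e) pre_digraph \<Rightarrow> bool" where
  "rho_spanning_tree G \<rho> T \<longleftrightarrow>
     spanning T G \<and> H1 T \<rho> = {0} \<and> bij_betw (H0_incl G \<rho>) (H0 T \<rho>) (H0 G \<rho>)"

definition weight ::
    "('e \<Rightarrow> complex) \<Rightarrow> ('e \<Rightarrow> real) \<Rightarrow> ('v, 'e) pre_digraph \<Rightarrow> complex" where
  "weight \<rho> r T = rho_hat T \<rho> * (\<Prod>b \<in> arcs T. inverse (complex_of_real (r b)))"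

definition chain_inner ::
    "('v, 'e) pre_digraph \<Rightarrow> ('e \<Rightarrow> complex) \<Rightarrow> ('e \<Rightarrow> complex) \<Rightarrow> complex" where
  "chain_inner A x y = (\<Sum>b \<in> arcs A. x b * cnj (y b))"

definition B1 :: "('v, 'e) pre_digraph \<Rightarrow> ('e \<Rightarrow> complex) \<Rightarrow> ('e \<Rightarrow> complex) set" where
  "B1 A \<rho> = {x \<in> C1 A. \<forall>z \<in> Z1 A \<rho>. chain_inner A x z = 0}"

definition resistance_op :: "('e \<Rightarrow> real) \<Rightarrow> ('e \<Rightarrow> complex) \<Rightarrow> 'e \<Rightarrow> complex" where
  "resistance_op r x = (\<lambda>b. complex_of_real (r b) * x b)"

definition Tbar_edge ::
    "('v, 'e) pre_digraph \<Rightarrow> ('e \<Rightarrow> complex) \<Rightarrow> ('v, 'e) pre_digraph \<Rightarrow> 'e \<Rightarrow> 'e \<Rightarrow> complex" where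
  "Tbar_edge G \<rho> T b =
     (if b \<in> arcs T then 0
      else let c = (SOME c. c \<in> H1 (pre_digraph.add_arc T b) \<rho> \<and> c \<noteq> 0)
           in (\<lambda>e. c e / chain_inner G c (cell b)))"

definition Tbar ::
    "('v, 'e) pre_digraph \<Rightarrow> ('e \<Rightarrow> complex) \<Rightarrow> ('v, 'e) pre_digraph \<Rightarrow>
     ('e \<Rightarrow> complex) \<Rightarrow> 'e \<Rightarrow> complex" where
  "Tbar G \<rho> T x = (\<lambda>e. \<Sum>b \<in> arcs G. x b * Tbar_edge G \<rho> T b e)"

end

theory Submission
  imports Defs "HOL-Combinatorics.Permutations"
begin

text \<open>
  Let \<open>P\<close> be the weighted average of the operators \<open>T\<close>-bar over all spanning trees, with
  weights \<open>w\<^sub>T / \<Delta>\<close>. The theorem follows once \<open>P\<close> is known to be the projection onto the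
  cycles that is orthogonal for the inner product weighted by the resistances: the law
  \<open>V - R z \<in> B\<^sup>1\<close> says that \<open>z\<close> is the orthogonal projection of \<open>R\<^sup>-\<^sup>1 V\<close>, and the
  formula for \<open>\<langle>z, b\<rangle>\<close> is obtained by moving \<open>P\<close> to the other argument.

  Each single \<open>T\<close>-bar already maps into the cycles and fixes them, because a cycle is determined
  by its coefficients off the tree (\<open>cycle_eq_sum_fundamental_cycles\<close>). Self-adjointness holds
  only for the average and comes from exchanging edges. If the fundamental cycle of \<open>b\<close> with
  respect to \<open>T\<close> has coefficient \<open>a \<noteq> 0\<close> at the tree edge \<open>e\<close>, then \<open>T' = T + b - e\<close> is again a
  spanning tree, the fundamental cycle of \<open>e\<close> with respect to \<open>T'\<close> has coefficient \<open>1 / a\<close> at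
  \<open>b\<close>, and the two holonomy factors differ by \<open>\<bar>a\<bar>\<^sup>2\<close> (\<open>exchange\<close>). Hence the terms of \<open>T\<close> and
  \<open>T'\<close> in the two sides of the symmetry relation agree (\<open>exchange_weight\<close>,
  \<open>weighted_cycle_hermitian\<close>).

  The ratio \<open>\<bar>a\<bar>\<^sup>2\<close> is found through determinants. For a spanning tree the boundary operator is
  an invertible square matrix; replacing the column of \<open>e\<close> by that of \<open>b\<close> multiplies its
  determinant by \<open>- a\<close>, and the holonomy factor of the tree is the squared modulus of this
  determinant (\<open>rho_hat_eq_det\<close>). For the latter, invertibility yields a bijection from
  vertices to incident edges (\<open>transversal_of_invertible\<close>). Walking from each vertex across its
  edge gives a self-map of the vertices whose periodic orbits are exactly the circuits
  (\<open>orbit_is_circuit\<close>, \<open>circuit_is_orbit\<close>), one in each component, and up to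
  unit factors the matrix is the identity minus a weighted map, whose determinant is the product
  over the periodic orbits of one minus the total weight (\<open>det_on_functional\<close>).
\<close>

section \<open>Determinants indexed by a finite set\<close>

definition det_on :: "'a set \<Rightarrow> ('a \<Rightarrow> 'a \<Rightarrow> complex) \<Rightarrow> complex" where
  "det_on S A = (\<Sum>p | p permutes S. of_int (sign p) * (\<Prod>v\<in>S. A v (p v)))"

lemma det_on_cong:
  assumes "\<And>v w. v \<in> S \<Longrightarrow> w \<in> S \<Longrightarrow> A v w = B v w"
  shows "det_on S A = det_on S B"
  unfolding det_on_def
  by (intro sum.cong refl arg_cong2[where f="(*)"] prod.cong)
     (auto intro!: assms simp: permutes_in_image)

lemma det_on_scale:
  "det_on S (\<lambda>v w. a v * A v w) = (\<Prod>v\<in>S. a v) * det_on S A"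
  by (simp add: det_on_def prod.distrib sum_distrib_left mult_ac)

lemma det_on_sum_row:
  assumes "finite S" "v \<in> S"
  shows "det_on S (A(v := \<lambda>w. \<Sum>i\<in>I. c i * B i w)) = (\<Sum>i\<in>I. c i * det_on S (A(v := B i)))"
proof -
  have row: "(\<Prod>u\<in>S. (A(v := D)) u (p u)) = D (p v) * (\<Prod>u\<in>S - {v}. A u (p u))" for D p
    using assms by (simp add: prod.remove[where x=v])
  show ?thesis
    unfolding det_on_def row sum_distrib_left sum_distrib_right
    by (subst sum.swap) (simp add: mult_ac)
qed

lemma det_on_permute_rows:
  assumes "finite S" "q permutes S"
  shows "det_on S (A \<circ> q) = of_int (sign q) * det_on S A"
proof -
  have "det_on S (A \<circ> q) = (\<Sum>p | p permutes S. of_int (sign (p \<circ> q)) * (\<Prod>v\<in>S. A (q v) (p (q v))))"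
    using sum_permutations_compose_right[OF assms(2),
        of "\<lambda>p. of_int (sign p) * (\<Prod>v\<in>S. A (q v) (p v))"]
    by (simp add: det_on_def)
  also have "\<dots> = (\<Sum>p | p permutes S. of_int (sign q) * (of_int (sign p) * (\<Prod>v\<in>S. A v (p v))))"
  proof (rule sum.cong[OF refl])
    fix p assume "p \<in> {p. p permutes S}"
    then have "sign (p \<circ> q) = sign p * sign q"
      using assms by (auto intro!: sign_compose permutation_permutes[THEN iffD2])
    moreover have "(\<Prod>v\<in>S. A (q v) (p (q v))) = (\<Prod>v\<in>S. A v (p v))"
      by (rule prod.reindex_bij_betw[OF permutes_imp_bij[OF assms(2)]])
    ultimately show "of_int (sign (p \<circ> q)) * (\<Prod>v\<in>S. A (q v) (p (q v)))
        = of_int (sign q) * (of_int (sign p) * (\<Prod>v\<in>S. A v (p v)))"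
      by simp
  qed
  finally show ?thesis
    by (simp add: det_on_def sum_distrib_left)
qed

text \<open>
  Exchanging the two equal rows changes the sign but not the matrix.
\<close>

lemma det_on_equal_rows:
  assumes "finite S" "i \<in> S" "j \<in> S" "i \<noteq> j" "A i = A j"
  shows "det_on S A = 0"
proof -
  have "A \<circ> Transposition.transpose i j = A"
    using assms(5) by (auto simp: fun_eq_iff Transposition.transpose_def)
  then show ?thesis
    using det_on_permute_rows[OF assms(1) permutes_swap_id[OF assms(2,3)], of A] assms(4)
    by (simp add: sign_swap_id)
qed

text \<open>
  All summands but the one for \<open>v\<close> itself produce two equal rows. This single rule performs both
  the elimination in a functional digraph and the exchange of an edge in a spanning tree.
\<close>

lemma det_on_combine_rows:
  assumes "finite S" "v \<in> S"
  shows "det_on S (A(v := \<lambda>w. \<Sum>u\<in>S. c u * A u w)) = c v * det_on S A"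
proof -
  have "det_on S (A(v := A u)) = 0" if "u \<in> S - {v}" for u
    using that assms by (intro det_on_equal_rows[of S v u]) auto
  then show ?thesis
    unfolding det_on_sum_row[OF assms]
    using assms by (simp add: sum.remove[where x=v])
qed

text \<open>
  The modulus of the determinant of a family of rows depends only on the set \<open>F\<close> of labels, not on
  how the labels are matched with \<open>S\<close>; it is therefore an invariant of the edge set of a tree.
\<close>

lemma cmod_det_on_bij_eq:
  assumes "finite S" "bij_betw \<sigma> S F" "bij_betw \<tau> S F"
  shows "cmod (det_on S (\<lambda>v. A (\<tau> v))) = cmod (det_on S (\<lambda>v. A (\<sigma> v)))"
proof -
  define q where "q v = (if v \<in> S then the_inv_into S \<sigma> (\<tau> v) else v)" for v
  have "bij_betw (the_inv_into S \<sigma> \<circ> \<tau>) S S"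
    using assms(2,3) by (blast intro: bij_betw_trans bij_betw_the_inv_into)
  then have "bij_betw q S S"
    by (rule bij_betw_cong[THEN iffD1, rotated]) (simp add: q_def)
  then have q: "q permutes S"
    by (rule bij_imp_permutes) (simp add: q_def)
  have "\<sigma> (q v) = \<tau> v" if "v \<in> S" for v
    using that assms(2,3) f_the_inv_into_f_bij_betw[OF assms(2), of "\<tau> v"]
    by (auto simp: q_def bij_betw_def)
  then have "det_on S (\<lambda>v. A (\<tau> v)) = det_on S ((\<lambda>v. A (\<sigma> v)) \<circ> q)"
    by (intro det_on_cong) simp
  then show ?thesis
    by (simp add: det_on_permute_rows[OF assms(1) q] norm_mult) (simp add: sign_def)
qed


section \<open>Functional digraphs\<close>

text \<open>
  Once the rows at the roots \<open>R\<close> are unit vectors, the matrix is unitriangular for the order by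
  distance to \<open>R\<close>. In the Leibniz formula, a permutation with nonzero contribution that moves \<open>v\<close>
  sends it to \<open>f v\<close>, hence also moves \<open>f v\<close>; this runs along the orbit until it
  contradicts that roots are fixed. So only the identity contributes.
\<close>

lemma det_on_unipotent_functional:
  assumes "finite S" "\<And>v. v \<in> S \<Longrightarrow> f v \<in> S" "R \<subseteq> S"
    and reach: "\<And>v. v \<in> S \<Longrightarrow> \<exists>k. (f ^^ k) v \<in> R"
  shows "det_on S (\<lambda>v w. if v \<in> R then cell v w else cell v w - u v * cell (f v) w) = 1"
proof -
  let ?M = "\<lambda>v w. if v \<in> R then cell v w else cell v w - u v * cell (f v) w"
  have id: "p = id" if p: "p permutes S" and nz: "(\<Prod>v\<in>S. ?M v (p v)) \<noteq> 0" for p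
  proof -
    have M: "?M v (p v) \<noteq> 0" if "v \<in> S" for v
      using nz assms(1) that by auto
    have "\<lbrakk>v \<in> S; (f ^^ k) v \<in> R\<rbrakk> \<Longrightarrow> p v = v" for v k
    proof (induction k arbitrary: v)
      case 0
      then show ?case using M[OF 0(1)] by (auto simp: cell_def split: if_splits)
    next
      case (Suc k)
      show ?case
      proof (rule ccontr)
        assume "p v \<noteq> v"
        with M[OF Suc.prems(1)] have "p v = f v"
          by (auto simp: cell_def split: if_splits)
        moreover have "p (f v) = f v"
          using Suc.prems assms(2) by (intro Suc.IH) (simp_all add: funpow_swap1)
        ultimately have "v = f v"
          using p by (metis permutes_inj injD)
        then show False using \<open>p (f v) = f v\<close> \<open>p v \<noteq> v\<close> by metis
      qed
    qed
    then have "p v = v" for v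
      using reach[of v] permutes_not_in[OF p, of v] by (cases "v \<in> S") blast+
    then show ?thesis by auto
  qed
  have diag: "?M v v = 1" if "v \<in> S" for v
  proof (cases "v \<in> R \<or> f v \<noteq> v")
    case False
    then have fixed: "f v = v" "v \<notin> R" by auto
    then have "(f ^^ k) v = v" for k by (induction k) auto
    with reach[OF that] fixed show ?thesis by auto
  qed (auto simp: cell_def)
  have "det_on S ?M = (\<Sum>p\<in>{id}. of_int (sign p) * (\<Prod>v\<in>S. ?M v (p v)))"
    unfolding det_on_def
  proof (rule sum.mono_neutral_right)
    show "\<forall>p\<in>{p. p permutes S} - {id}. of_int (sign p) * (\<Prod>v\<in>S. ?M v (p v)) = 0"
    proof
      fix p assume "p \<in> {p. p permutes S} - {id}"
      with id[of p] have "(\<Prod>v\<in>S. ?M v (p v)) = 0" by blast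
      then show "of_int (sign p) * (\<Prod>v\<in>S. ?M v (p v)) = 0" by (simp only: mult_zero_right)
    qed
  qed (use assms(1) in \<open>auto simp: finite_permutations permutes_id\<close>)
  also have "\<dots> = (\<Prod>v\<in>S. ?M v (id v))"
    by (simp only: sum.insert_remove sum.empty finite.emptyI empty_Diff sign_id of_int_1) simp
  also have "\<dots> = 1"
    unfolding id_apply by (rule prod.neutral) (use diag in blast)
  finally show ?thesis .
qed

text \<open>
  Along a periodic orbit the rows telescope: summing them with the partial products of the weights
  as coefficients leaves a multiple of the unit vector at \<open>r\<close>. The coefficient at \<open>r\<close> itself is
  \<open>1\<close>, so that this is a legitimate row operation.
\<close>

lemma cycle_combination:
  fixes f :: "'a \<Rightarrow> 'a" and u :: "'a \<Rightarrow> complex"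
  assumes "finite S" "\<And>v. v \<in> S \<Longrightarrow> f v \<in> S" "r \<in> S"
    and "0 < n" "(f ^^ n) r = r" "inj_on (\<lambda>k. (f ^^ k) r) {..<n}"
  obtains y where "y r = 1" "\<And>v. y v \<noteq> 0 \<Longrightarrow> \<exists>k. v = (f ^^ k) r"
    "\<And>w. (\<Sum>v\<in>S. y v * (cell v w - u v * cell (f v) w)) = (1 - (\<Prod>k<n. u ((f ^^ k) r))) * cell r w"
proof -
  define c where "c k = (\<Prod>j<k. u ((f ^^ j) r))" for k
  define y where "y v = (\<Sum>k<n. if v = (f ^^ k) r then c k else 0)" for v
  have orbit: "(f ^^ k) r \<in> S" for k
    using assms(2,3) by (induction k) auto
  have "(if r = (f ^^ k) r then c k else 0) = (if k = 0 then 1 else 0)" if "k < n" for k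
    using inj_onD[OF assms(6), of k 0] that assms(4) by (auto simp: c_def)
  then have "y r = (\<Sum>k<n. if k = 0 then 1 else 0)"
    unfolding y_def by (intro sum.cong) auto
  then have "y r = 1"
    using assms(4) by simp
  moreover have "\<exists>k. v = (f ^^ k) r" if "y v \<noteq> 0" for v
  proof (rule ccontr)
    assume "\<nexists>k. v = (f ^^ k) r"
    then have "y v = 0" by (simp add: y_def)
    with that show False by simp
  qed
  moreover have "(\<Sum>v\<in>S. y v * (cell v w - u v * cell (f v) w))
      = (1 - (\<Prod>k<n. u ((f ^^ k) r))) * cell r w" for w
  proof -
    have "(\<Sum>v\<in>S. y v * (cell v w - u v * cell (f v) w))
        = (\<Sum>k<n. \<Sum>v\<in>S. (if v = (f ^^ k) r then c k * (cell v w - u v * cell (f v) w) else 0))"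
      unfolding y_def sum_distrib_right
      by (subst sum.swap) (auto intro!: sum.cong)
    also have "\<dots> = (\<Sum>k<n. c k * cell ((f ^^ k) r) w - c (Suc k) * cell ((f ^^ Suc k) r) w)"
      using assms(1) orbit by (intro sum.cong) (auto simp: c_def algebra_simps)
    also have "\<dots> = c 0 * cell r w - c n * cell ((f ^^ n) r) w"
      using sum_lessThan_telescope'[of "\<lambda>k. c k * cell ((f ^^ k) r) w" n] by simp
    finally show ?thesis
      using assms(5) by (simp add: c_def algebra_simps)
  qed
  ultimately show thesis by (rule that)
qed

text \<open>
  The determinant of the identity minus a weighted self-map. The roots \<open>R\<close> contain one point of each
  periodic orbit, with period \<open>n r\<close>. The rows at the roots are replaced one after the other by
  multiples of unit vectors; the combination used for \<open>r\<close> involves only the orbit of \<open>r\<close>,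
  which contains none of the rows replaced before.
\<close>

theorem det_on_functional:
  fixes f :: "'a \<Rightarrow> 'a" and u :: "'a \<Rightarrow> complex" and n :: "'a \<Rightarrow> nat"
  assumes "finite S" "\<And>v. v \<in> S \<Longrightarrow> f v \<in> S" "R \<subseteq> S"
    and reach: "\<And>v. v \<in> S \<Longrightarrow> \<exists>k. (f ^^ k) v \<in> R"
    and period: "\<And>r. r \<in> R \<Longrightarrow> 0 < n r \<and> (f ^^ n r) r = r \<and> inj_on (\<lambda>k. (f ^^ k) r) {..<n r}"
    and unique: "\<And>r k. r \<in> R \<Longrightarrow> (f ^^ k) r \<in> R \<Longrightarrow> (f ^^ k) r = r"
  shows "det_on S (\<lambda>v w. cell v w - u v * cell (f v) w)
    = (\<Prod>r\<in>R. 1 - (\<Prod>k<n r. u ((f ^^ k) r)))"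
proof -
  let ?M = "\<lambda>X v w. if v \<in> X then cell v w else cell v w - u v * cell (f v) w"
  let ?h = "\<lambda>r. 1 - (\<Prod>k<n r. u ((f ^^ k) r))"
  have step: "det_on S (?M X) = ?h r * det_on S (?M (insert r X))"
    if r: "r \<in> R" "r \<notin> X" and X: "X \<subseteq> R" for r X
  proof -
    from r(1) assms(3) have rS: "r \<in> S" by auto
    obtain y where y: "y r = 1" "\<And>v. y v \<noteq> 0 \<Longrightarrow> \<exists>k. v = (f ^^ k) r"
      "\<And>w. (\<Sum>v\<in>S. y v * (cell v w - u v * cell (f v) w)) = ?h r * cell r w"
      using cycle_combination[where f=f, OF assms(1,2) rS] period[OF r(1)] by blast
    have "y v = 0" if "v \<in> X" for v
    proof (rule ccontr)
      assume "y v \<noteq> 0"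
      then obtain k where "v = (f ^^ k) r" using y(2) by blast
      then show False using unique[OF r(1), of k] that r(2) X by auto
    qed
    then have eq: "(\<Sum>v\<in>S. y v * ?M X v w) = ?h r * cell r w" for w
      unfolding y(3)[symmetric] by (intro sum.cong) auto
    have "det_on S (?M X) = det_on S ((?M X)(r := \<lambda>w. \<Sum>v\<in>S. y v * ?M X v w))"
      using det_on_combine_rows[OF assms(1) rS, of "?M X" y] y(1) by simp
    also have "\<dots> = det_on S ((?M X)(r := \<lambda>w. \<Sum>i\<in>{()}. ?h r * cell r w))"
      by (simp add: eq)
    also have "\<dots> = ?h r * det_on S ((?M X)(r := cell r))"
      by (subst det_on_sum_row[OF assms(1) rS]) simp
    also have "(?M X)(r := cell r) = ?M (insert r X)"
      by (auto simp: fun_eq_iff)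
    finally show ?thesis .
  qed
  have "finite R" using assms(1,3) by (rule rev_finite_subset)
  have "det_on S (?M {}) = (\<Prod>r\<in>X. ?h r) * det_on S (?M X)" if "X \<subseteq> R" for X
    using finite_subset[OF that \<open>finite R\<close>] that
  proof (induction X rule: finite_induct)
    case (insert r X)
    then show ?case using step[of r X] by simp
  qed simp
  from this[of R] show ?thesis
    using det_on_unipotent_functional[OF assms(1-4), of u] by simp
qed


section \<open>Transversals of invertible matrices\<close>

text \<open>
  A square matrix with nonzero determinant has a nonzero term in its Leibniz expansion. The proof is
  by induction on the rows and also yields that the matrix is square: some entry in row \<open>v\<close> and
  column \<open>b\<close> is nonzero together with the opposite entry \<open>x b\<close> of the inverse matrix, and by
  Cramer's rule the minor without this row and column is again invertible.
\<close>

lemma transversal_of_invertible: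
  fixes A :: "'e \<Rightarrow> 'v \<Rightarrow> complex"
  assumes "finite V" "finite F"
    and inj: "\<And>x. \<lbrakk>\<forall>b. b \<notin> F \<longrightarrow> x b = 0; \<forall>v\<in>V. (\<Sum>b\<in>F. x b * A b v) = 0\<rbrakk> \<Longrightarrow> \<forall>b. x b = 0"
    and surj: "\<And>y. \<exists>x. (\<forall>b. b \<notin> F \<longrightarrow> x b = 0) \<and> (\<forall>v\<in>V. (\<Sum>b\<in>F. x b * A b v) = y v)"
  shows "\<exists>\<sigma>. bij_betw \<sigma> V F \<and> (\<forall>v\<in>V. A (\<sigma> v) v \<noteq> 0)"
  using assms
proof (induction V arbitrary: F rule: finite_induct)
  case empty
  have "b \<notin> F" for b
  proof
    assume "b \<in> F"
    then have "\<forall>c. c \<notin> F \<longrightarrow> cell b c = 0" by (auto simp: cell_def)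
    then have "cell b b = 0" using empty.prems(2) by blast
    then show False by (simp add: cell_def)
  qed
  then show ?case by (auto simp: bij_betw_def)
next
  case (insert v V F)
  obtain x where x: "\<forall>b. b \<notin> F \<longrightarrow> x b = 0"
    "\<forall>w\<in>insert v V. (\<Sum>b\<in>F. x b * A b w) = cell v w"
    using insert.prems(3)[of "cell v"] by blast
  \<comment> \<open>\<open>x\<close> is the column at \<open>v\<close> of the inverse matrix; correcting by multiples of \<open>x\<close>
      adjusts row \<open>v\<close> without disturbing the other rows.\<close>
  then have "(\<Sum>b\<in>F. x b * A b v) \<noteq> 0" by (simp add: cell_def)
  then obtain b where b: "b \<in> F" "x b * A b v \<noteq> 0"
    by (meson sum.not_neutral_contains_not_neutral)
  have remove: "(\<Sum>a\<in>F - {b}. z a * A a w) = (\<Sum>a\<in>F. z a * A a w)" if "z b = 0" for z w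
    using insert.prems(1) b(1) that by (simp add: sum.remove)
  have "\<exists>\<sigma>. bij_betw \<sigma> V (F - {b}) \<and> (\<forall>v\<in>V. A (\<sigma> v) v \<noteq> 0)"
  proof (rule insert.IH)
    show "finite (F - {b})" using insert.prems(1) by simp
  next
    fix z assume z: "\<forall>a. a \<notin> F - {b} \<longrightarrow> z a = 0" "\<forall>w\<in>V. (\<Sum>a\<in>F - {b}. z a * A a w) = 0"
    define l where "l = (\<Sum>a\<in>F. z a * A a v)"
    have "\<forall>a. z a - l * x a = 0"
    proof (rule insert.prems(2))
      show "\<forall>a. a \<notin> F \<longrightarrow> z a - l * x a = 0" using z(1) x(1) by simp
      have "(\<Sum>a\<in>F. (z a - l * x a) * A a w) = (\<Sum>a\<in>F. z a * A a w) - l * (\<Sum>a\<in>F. x a * A a w)" for w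
        by (simp add: sum_subtractf sum_distrib_left algebra_simps)
      then show "\<forall>w\<in>insert v V. (\<Sum>a\<in>F. (z a - l * x a) * A a w) = 0"
        using z x(2) insert.hyps(2) by (auto simp: l_def remove cell_def)
    qed
    moreover from this have "l = 0" using z(1) b by (metis DiffD2 diff_0 mult_eq_0_iff neg_equal_0_iff_equal singletonI)
    ultimately show "\<forall>a. z a = 0" by simp
  next
    fix y
    obtain z where z: "\<forall>a. a \<notin> F \<longrightarrow> z a = 0" "\<forall>w\<in>insert v V. (\<Sum>a\<in>F. z a * A a w) = y w"
      using insert.prems(3)[of y] by blast
    define z' where "z' a = z a - z b / x b * x a" for a
    have "z' b = 0" using b(2) by (simp add: z'_def)
    moreover have "(\<Sum>a\<in>F. z' a * A a w) = (\<Sum>a\<in>F. z a * A a w) - z b / x b * (\<Sum>a\<in>F. x a * A a w)" for w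
      by (simp add: z'_def sum_subtractf sum_distrib_left algebra_simps)
    moreover have "\<forall>a. a \<notin> F \<longrightarrow> z' a = 0" using z(1) x(1) by (simp add: z'_def)
    ultimately have "(\<forall>a. a \<notin> F - {b} \<longrightarrow> z' a = 0) \<and> (\<forall>w\<in>V. (\<Sum>a\<in>F - {b}. z' a * A a w) = y w)"
      using z(2) x(2) insert.hyps(2) by (auto simp: remove cell_def)
    then show "\<exists>z. (\<forall>a. a \<notin> F - {b} \<longrightarrow> z a = 0) \<and> (\<forall>w\<in>V. (\<Sum>a\<in>F - {b}. z a * A a w) = y w)"
      by blast
  qed
  then obtain \<sigma> where \<sigma>: "bij_betw \<sigma> V (F - {b})" "\<forall>v\<in>V. A (\<sigma> v) v \<noteq> 0" by blast
  have "bij_betw (\<sigma>(v := b)) V (F - {b})"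
    using \<sigma>(1) insert.hyps(2) by (subst bij_betw_cong[of V _ \<sigma>]) auto
  then have "bij_betw (\<sigma>(v := b)) (V \<union> {v}) (F - {b} \<union> {b})"
    by (rule bij_betw_combine) (auto simp: bij_betw_def)
  then have "bij_betw (\<sigma>(v := b)) (insert v V) F"
    using b(1) by (simp add: insert_absorb)
  moreover have "\<forall>w\<in>insert v V. A ((\<sigma>(v := b)) w) w \<noteq> 0"
    using \<sigma>(2) b(2) by auto
  ultimately show ?case by blast
qed


section \<open>Connected components\<close>

text \<open>
  Connectedness as an induction principle: a property that passes along edges in both directions and
  holds somewhere holds everywhere.
\<close>

lemma (in wf_digraph) connected_iff_closed:
  "Digraph_Component.connected G \<longleftrightarrow> verts G \<noteq> {} \<and>
    (\<forall>X. X \<inter> verts G \<noteq> {} \<longrightarrow> (\<forall>b\<in>arcs G. tail G b \<in> X \<longleftrightarrow> head G b \<in> X) \<longrightarrow> verts G \<subseteq> X)"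
  (is "_ \<longleftrightarrow> ?ne \<and> ?closed")
proof (intro iffI conjI)
  assume con: "Digraph_Component.connected G"
  then show ?ne by (simp add: connected_conv)
  show ?closed
  proof (intro allI impI)
    fix X assume X: "X \<inter> verts G \<noteq> {}" "\<forall>b\<in>arcs G. tail G b \<in> X \<longleftrightarrow> head G b \<in> X"
    from X(1) obtain u where u: "u \<in> X" "u \<in> verts G" by auto
    have "v \<in> X" if "(u, v) \<in> rtrancl_on (verts G) ((arcs_ends G)\<^sup>s)" for v
      using that
    proof (induction rule: rtrancl_on_induct)
      case (step w v)
      then show ?case using X(2) by (auto simp: symcl_def arcs_ends_conv)
    qed (use u in auto)
    then show "verts G \<subseteq> X" using con u by (auto simp: connected_conv)
  qed
next
  assume R: "?ne \<and> ?closed"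
  have "(u, v) \<in> rtrancl_on (verts G) ((arcs_ends G)\<^sup>s)" if uv: "u \<in> verts G" "v \<in> verts G" for u v
  proof -
    let ?X = "{v. (u, v) \<in> rtrancl_on (verts G) ((arcs_ends G)\<^sup>s)}"
    have "u \<in> ?X \<inter> verts G" using uv by auto
    moreover have "tail G b \<in> ?X \<longleftrightarrow> head G b \<in> ?X" if b: "b \<in> arcs G" for b
    proof -
      have "(tail G b, head G b) \<in> (arcs_ends G)\<^sup>s" "(head G b, tail G b) \<in> (arcs_ends G)\<^sup>s"
        using b by (auto simp: symcl_def arcs_ends_conv)
      then show ?thesis
        using b by (auto intro: rtrancl_on_into_rtrancl_on)
    qed
    ultimately have "verts G \<subseteq> ?X" using R by blast
    then show ?thesis using uv by auto
  qed
  then show "Digraph_Component.connected G" using R by (auto simp: connected_conv)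
qed

lemma componentsD:
  assumes "H \<in> components G"
  shows "subgraph H G" "Digraph_Component.connected H"
    "\<And>K. \<lbrakk>Digraph_Component.connected K; subgraph H K; subgraph K G\<rbrakk> \<Longrightarrow> K = H"
  using assms by (auto simp: components_def pre_digraph.max_subgraph_def)

text \<open>
  The union of two connected subgraphs with a common vertex is connected, so maximality makes both
  equal to it.
\<close>

lemma components_disjoint:
  assumes H: "H \<in> components G" and K: "K \<in> components G" and v: "v \<in> verts H" "v \<in> verts K"
  shows "H = K"
proof -
  let ?U = "union H K"
  note sub = componentsD(1)[OF H] componentsD(1)[OF K]
  interpret G: wf_digraph G using sub by auto
  interpret H: wf_digraph H using sub by auto
  interpret K: wf_digraph K using sub by auto
  have ends: "tail H = tail G" "head H = head G" "tail K = tail G" "head K = head G"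
    using sub by (auto simp: subgraph_def compatible_def)
  interpret U: wf_digraph ?U
    using H.wellformed K.wellformed by unfold_locales (auto simp: union_def ends)
  have "Digraph_Component.connected ?U"
    unfolding U.connected_iff_closed
  proof (intro conjI allI impI)
    show "verts ?U \<noteq> {}" using v by (auto simp: union_def)
    fix X assume X: "X \<inter> verts ?U \<noteq> {}" "\<forall>b\<in>arcs ?U. (tail ?U b \<in> X) = (head ?U b \<in> X)"
    have "X \<inter> verts H \<noteq> {} \<Longrightarrow> verts H \<subseteq> X" "X \<inter> verts K \<noteq> {} \<Longrightarrow> verts K \<subseteq> X"
      using X(2) componentsD(2)[OF H] componentsD(2)[OF K]
      unfolding H.connected_iff_closed K.connected_iff_closed by (auto simp: union_def ends)
    then show "verts ?U \<subseteq> X"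
      using v X(1) by (auto simp: union_def)
  qed
  moreover have "subgraph ?U G" "subgraph H ?U" "subgraph K ?U"
    using sub G.wf_digraph_axioms H.wf_digraph_axioms K.wf_digraph_axioms U.wf_digraph_axioms
    by (auto simp: subgraph_def compatible_def union_def)
  ultimately show ?thesis
    using componentsD(3)[OF H] componentsD(3)[OF K] by metis
qed

text \<open>
  Adding an edge at a vertex of a connected subgraph keeps it connected.
\<close>

lemma arc_in_component:
  assumes H: "H \<in> components G" and b: "b \<in> arcs G" "tail G b \<in> verts H \<or> head G b \<in> verts H"
  shows "b \<in> arcs H"
proof -
  note sub = componentsD(1)[OF H]
  interpret G: wf_digraph G using sub by auto
  interpret H: wf_digraph H using sub by auto
  have ends: "tail H = tail G" "head H = head G"
    using sub by (auto simp: subgraph_def compatible_def)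
  let ?K = "H.add_arc b"
  interpret K: wf_digraph ?K by (rule H.wf_digraph_add_arc)
  have "Digraph_Component.connected ?K"
    unfolding K.connected_iff_closed
  proof (intro conjI allI impI)
    show "verts ?K \<noteq> {}" by (auto simp: H.verts_add_arc_conv)
    fix X assume X: "X \<inter> verts ?K \<noteq> {}" "\<forall>c\<in>arcs ?K. (tail ?K c \<in> X) = (head ?K c \<in> X)"
    then have "X \<inter> verts H \<noteq> {} \<Longrightarrow> verts H \<subseteq> X"
      using componentsD(2)[OF H] unfolding H.connected_iff_closed by auto
    then show "verts ?K \<subseteq> X"
      using X b by (auto simp: H.verts_add_arc_conv ends)
  qed
  moreover have "subgraph ?K G" "subgraph H ?K"
    using sub b G.wf_digraph_axioms H.wf_digraph_axioms K.wf_digraph_axioms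
    by (auto simp: subgraph_def compatible_def H.verts_add_arc_conv ends)
  ultimately have "?K = H" by (intro componentsD(3)[OF H])
  then have "arcs ?K = arcs H" by simp
  then show ?thesis by auto
qed

text \<open>
  Start from the single vertex \<open>v\<close> and take a connected subgraph around it of greatest size.
\<close>

lemma (in fin_digraph) in_some_component:
  assumes "v \<in> verts G"
  shows "\<exists>H\<in>components G. v \<in> verts H"
proof -
  let ?P = "\<lambda>K. subgraph K G \<and> Digraph_Component.connected K \<and> v \<in> verts K"
  let ?size = "\<lambda>K :: ('a, 'b) pre_digraph. card (verts K) + card (arcs K)"
  let ?v = "\<lparr>verts = {v}, arcs = {}, tail = tail G, head = head G\<rparr>"
  interpret v: wf_digraph ?v by unfold_locales auto
  have "?P ?v"
    using assms v.wf_digraph_axioms wf_digraph_axioms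
    unfolding v.connected_iff_closed by (auto simp: subgraph_def compatible_def)
  moreover have "\<forall>K. ?P K \<longrightarrow> ?size K < Suc (?size G)"
    by (auto simp: subgraph_def less_Suc_eq_le intro!: add_mono card_mono)
  ultimately have "\<exists>H. ?P H \<and> (\<forall>K. ?P K \<longrightarrow> ?size K \<le> ?size H)"
    by (intro ex_has_greatest_nat[where P="?P" and f="?size" and b="Suc (?size G)"])
  then obtain H where H: "?P H" "\<And>K. ?P K \<Longrightarrow> ?size K \<le> ?size H"
    by auto
  have "K = H" if K: "Digraph_Component.connected K" "subgraph H K" "subgraph K G" for K
  proof -
    have sub: "verts H \<subseteq> verts K" "arcs H \<subseteq> arcs K" and ends: "tail K = tail H" "head K = head H"
      using K(2) by (auto simp: subgraph_def compatible_def)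
    have fin: "finite (verts K)" "finite (arcs K)"
      using K(3) finite_verts finite_arcs by (auto simp: subgraph_def intro: finite_subset)
    have "?size K \<le> ?size H" using H K sub by auto
    moreover have "card (verts H) \<le> card (verts K)" "card (arcs H) \<le> card (arcs K)"
      using sub fin by (auto intro: card_mono)
    ultimately have "verts H = verts K" "arcs H = arcs K"
      using card_seteq[OF fin(1) sub(1)] card_seteq[OF fin(2) sub(2)] by auto
    with ends show ?thesis by (intro pre_digraph.equality) auto
  qed
  with H(1) show ?thesis
    by (auto simp: components_def max_subgraph_def)
qed


section \<open>Circuits of a graph with an arc attached to each vertex\<close>

lemma (in pre_digraph) cas_iff_vertex_sequence:
  "cas u p v \<longleftrightarrow> (\<exists>x. x 0 = u \<and> x (length p) = v \<and>
    (\<forall>i<length p. tail G (p ! i) = x i \<and> head G (p ! i) = x (Suc i)))"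
proof (induction p arbitrary: u)
  case Nil
  then show ?case by auto
next
  case (Cons e p)
  show ?case (is "_ \<longleftrightarrow> (\<exists>x. ?Q x)")
  proof
    assume "cas u (e # p) v"
    then obtain x where x: "x 0 = head G e" "x (length p) = v" "tail G e = u"
      "\<forall>i<length p. tail G (p ! i) = x i \<and> head G (p ! i) = x (Suc i)"
      unfolding cas.simps Cons.IH by blast
    have "?Q (case_nat u x)"
      using x by (auto simp: nth_Cons split: nat.split)
    then show "\<exists>x. ?Q x" by (intro exI[of ?Q "case_nat u x"])
  next
    assume "\<exists>x. ?Q x"
    then obtain x where "?Q x" ..
    then have "(x \<circ> Suc) 0 = head G e \<and> (x \<circ> Suc) (length p) = v \<and> tail G e = u \<and>
        (\<forall>i<length p. tail G (p ! i) = (x \<circ> Suc) i \<and> head G (p ! i) = (x \<circ> Suc) (Suc i))"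
      by (metis Suc_less_eq comp_apply length_Cons nth_Cons_0 nth_Cons_Suc zero_less_Suc)
    then show "cas u (e # p) v"
      unfolding cas.simps Cons.IH by blast
  qed
qed

text \<open>
  By the pigeonhole principle the orbit of \<open>v\<close> runs into a period; with the least period, the points
  before the first return are distinct.
\<close>

lemma periodic_point_exists:
  assumes "finite S" "\<And>v. v \<in> S \<Longrightarrow> f v \<in> S" "v \<in> S"
  obtains r n where "r \<in> S" "0 < n" "(f ^^ n) r = r" "inj_on (\<lambda>k. (f ^^ k) r) {..<n}"
proof -
  have orbit: "(f ^^ k) v \<in> S" for k
    using assms(2,3) by (induction k) auto
  then have "\<not> inj (\<lambda>k. (f ^^ k) v)"
    using finite_subset[OF _ assms(1), of "range (\<lambda>k. (f ^^ k) v)"] finite_imageD infinite_UNIV_nat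
    by blast
  then obtain i j where ij: "i < j" "(f ^^ i) v = (f ^^ j) v"
    unfolding inj_def by (metis linorder_neqE_nat)
  define r where "r = (f ^^ i) v"
  define n where "n = (LEAST n. 0 < n \<and> (f ^^ n) r = r)"
  have "(f ^^ (j - i)) r = (f ^^ (j - i + i)) v"
    unfolding r_def funpow_add by simp
  then have "0 < j - i \<and> (f ^^ (j - i)) r = r"
    using ij by (simp add: r_def)
  then have n: "0 < n \<and> (f ^^ n) r = r"
    unfolding n_def by (rule LeastI)
  have False if ab: "a < b" "b < n" "(f ^^ a) r = (f ^^ b) r" for a b
  proof -
    have "(f ^^ (n - b + a)) r = (f ^^ (n - b + b)) r"
      unfolding funpow_add using ab(3) by simp
    then have "0 < n - b + a \<and> (f ^^ (n - b + a)) r = r"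
      using ab n by simp
    then have "n \<le> n - b + a"
      unfolding n_def by (rule Least_le)
    with ab show False by simp
  qed
  then have "inj_on (\<lambda>k. (f ^^ k) r) {..<n}"
    by (intro inj_onI) (metis lessThan_iff linorder_neqE_nat)
  with n orbit[of i] show thesis
    by (intro that[of r n]) (auto simp: r_def)
qed

definition edge_bdry :: "('v, 'e) pre_digraph \<Rightarrow> ('e \<Rightarrow> complex) \<Rightarrow> 'e \<Rightarrow> 'v \<Rightarrow> complex" where
  "edge_bdry G \<rho> b v = \<rho> b * cell (tail G b) v - cell (head G b) v"

lemma bdry_conv_edge_bdry: "bdry G \<rho> x v = (\<Sum>b\<in>arcs G. x b * edge_bdry G \<rho> b v)"
  by (simp add: bdry_def edge_bdry_def)

text \<open>
  The bijection \<open>\<sigma>\<close> assigns to each vertex an incident edge and uses each edge once. This orients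
  every component as a functional digraph: each vertex moves across its own edge.
\<close>

locale arc_transversal = fin_digraph G for G :: "('v, 'e) pre_digraph" +
  fixes \<rho> :: "'e \<Rightarrow> complex" and \<sigma> :: "'v \<Rightarrow> 'e"
  assumes unit: "\<And>b. b \<in> arcs G \<Longrightarrow> cmod (\<rho> b) = 1"
    and bij: "bij_betw \<sigma> (verts G) (arcs G)"
    and incident: "\<And>v. v \<in> verts G \<Longrightarrow> tail G (\<sigma> v) = v \<or> head G (\<sigma> v) = v"
begin

text \<open>
  With \<open>nxt\<close>, \<open>transport\<close> and \<open>scale\<close>, the boundary of the edge at \<open>v\<close> is a unit
  multiple of \<open>v\<close> minus a weighted \<open>nxt v\<close> (lemma \<open>edge_bdry_sigma\<close>). The weight of an edge
  traversed along its orientation is the inverse of its contribution to the holonomy.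
\<close>

definition nxt :: "'v \<Rightarrow> 'v" where
  "nxt v = (if tail G (\<sigma> v) = v then head G (\<sigma> v) else tail G (\<sigma> v))"

definition transport :: "'v \<Rightarrow> complex" where
  "transport v = (if tail G (\<sigma> v) = v then inverse (\<rho> (\<sigma> v)) else \<rho> (\<sigma> v))"

definition scale :: "'v \<Rightarrow> complex" where
  "scale v = (if tail G (\<sigma> v) = v then \<rho> (\<sigma> v) else - 1)"

lemma sigma_in: "v \<in> verts G \<Longrightarrow> \<sigma> v \<in> arcs G"
  using bij by (auto simp: bij_betw_def)

lemma sigma_inj: "v \<in> verts G \<Longrightarrow> w \<in> verts G \<Longrightarrow> \<sigma> v = \<sigma> w \<longleftrightarrow> v = w"
  using bij by (auto simp: bij_betw_def inj_on_def)

lemma nxt_in: "v \<in> verts G \<Longrightarrow> nxt v \<in> verts G"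
  using sigma_in by (auto simp: nxt_def)

lemma funpow_nxt_in: "v \<in> verts G \<Longrightarrow> (nxt ^^ k) v \<in> verts G"
  by (induction k) (auto simp: nxt_in)

lemma cmod_transport: "v \<in> verts G \<Longrightarrow> cmod (transport v) = 1"
  and cmod_scale: "v \<in> verts G \<Longrightarrow> cmod (scale v) = 1"
  using unit sigma_in by (auto simp: transport_def scale_def norm_inverse)

lemma edge_bdry_sigma:
  assumes "v \<in> verts G"
  shows "edge_bdry G \<rho> (\<sigma> v) w = scale v * (cell v w - transport v * cell (nxt v) w)"
proof -
  have "\<rho> (\<sigma> v) \<noteq> 0"
    using unit[OF sigma_in[OF assms]] by auto
  then show ?thesis
    using incident[OF assms]
    by (auto simp: edge_bdry_def scale_def transport_def nxt_def field_simps)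
qed

text \<open>
  An edge traversed with sign \<open>s\<close> from the vertex to which it is assigned. The second alternative
  occurs for loops only, whose two traversals start at the same vertex; \<open>transport\<close> knows just one
  of them.
\<close>

lemma traverse_forward:
  assumes "(if s then tail G (\<sigma> v) else head G (\<sigma> v)) = v"
    and "(if s then head G (\<sigma> v) else tail G (\<sigma> v)) = w"
  shows "nxt v = w \<and> (\<rho> (\<sigma> v) powi (if s then 1 else - 1) = inverse (transport v) \<or>
    v = w \<and> \<rho> (\<sigma> v) powi (if s then 1 else - 1) = transport v)"
  using assms by (cases s) (auto simp: nxt_def transport_def power_int_minus)

lemma traverse_backward:
  assumes "(if s then tail G (\<sigma> w) else head G (\<sigma> w)) = v"
    and "(if s then head G (\<sigma> w) else tail G (\<sigma> w)) = w"
  shows "nxt w = v \<and> (\<rho> (\<sigma> w) powi (if s then 1 else - 1) = transport w \<or>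
    v = w \<and> \<rho> (\<sigma> w) powi (if s then 1 else - 1) = inverse (transport w))"
  using assms by (cases s) (auto simp: nxt_def transport_def power_int_minus)

text \<open>
  A least period gives a closed walk with distinct vertices, and its edges are distinct because \<open>\<sigma>\<close>
  is injective; the latter excludes going back and forth along one edge.
\<close>

lemma orbit_is_circuit:
  assumes sub: "subgraph H G" and arcs: "\<And>v. v \<in> verts H \<Longrightarrow> \<sigma> v \<in> arcs H"
    and r: "r \<in> verts H" "0 < n" "(nxt ^^ n) r = r" "inj_on (\<lambda>k. (nxt ^^ k) r) {..<n}"
  shows "oriented_circuit H (map (\<lambda>k. let v = (nxt ^^ k) r in (\<sigma> v, tail G (\<sigma> v) = v)) [0..<n])"
    (is "oriented_circuit H ?p")
proof -
  let ?D = "oriented_edges H"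
  let ?x = "\<lambda>k. (nxt ^^ k) r"
  interpret H: wf_digraph H using sub by auto
  have ends: "tail H = tail G" "head H = head G" and vH: "verts H \<subseteq> verts G"
    using sub by (auto simp: subgraph_def compatible_def)
  have nxtH: "nxt v \<in> verts H" if "v \<in> verts H" for v
    using arcs[OF that] H.wellformed by (auto simp: nxt_def ends[symmetric])
  have x: "?x k \<in> verts H" for k
    using r(1) nxtH by (induction k) auto
  have p: "?p ! i = (\<sigma> (?x i), tail G (\<sigma> (?x i)) = ?x i)" if "i < n" for i
    using that by (simp add: Let_def)
  have heads: "tail ?D (?p ! i) = ?x i \<and> head ?D (?p ! i) = ?x (Suc i)" if "i < n" for i
    unfolding p[OF that] using incident[of "?x i"] x[of i] vH
    by (auto simp: oriented_edges_def ends nxt_def)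
  then have cas: "pre_digraph.cas ?D r ?p r"
    unfolding pre_digraph.cas_iff_vertex_sequence using r(3) by (intro exI[of _ ?x]) auto
  moreover have "set ?p \<subseteq> arcs ?D"
    using arcs[OF x] by (auto simp: oriented_edges_def Let_def)
  ultimately have "pre_digraph.awalk ?D r ?p r"
    using r(1) by (auto simp: pre_digraph.awalk_def oriented_edges_def)
  moreover have "distinct (tl (pre_digraph.awalk_verts ?D r ?p))"
  proof -
    have "tl (pre_digraph.awalk_verts ?D r ?p) = map (head ?D) ?p"
      using pre_digraph.awalk_verts_conv'[OF cas] by auto
    also have "\<dots> = map (\<lambda>k. ?x (Suc k)) [0..<n]"
      using heads by (intro nth_equalityI) auto
    also have "distinct \<dots>"
    proof -
      have "inj_on (\<lambda>k. ?x (Suc k)) {..<n}"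
      proof (rule inj_onI)
        fix i j assume ij: "i \<in> {..<n}" "j \<in> {..<n}" "?x (Suc i) = ?x (Suc j)"
        define i' where "i' = (if Suc i = n then 0 else Suc i)"
        define j' where "j' = (if Suc j = n then 0 else Suc j)"
        have "?x i' = ?x j'" "i' < n" "j' < n"
          using ij r(2,3) by (auto simp: i'_def j'_def simp del: funpow.simps)
        then have "i' = j'" using inj_onD[OF r(4), of i' j'] by simp
        then show "i = j" by (auto simp: i'_def j'_def split: if_splits)
      qed
      then show ?thesis by (simp add: distinct_map atLeast0LessThan)
    qed
    finally show ?thesis .
  qed
  moreover have "distinct (map fst ?p)"
  proof -
    have "inj_on (\<lambda>k. \<sigma> (?x k)) {..<n}"
      using r(4) x vH by (auto intro!: inj_onI simp: sigma_inj subset_iff dest: inj_onD)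
    then show ?thesis by (simp add: distinct_map atLeast0LessThan comp_def Let_def)
  qed
  ultimately show ?thesis
    using r(2) unfolding oriented_circuit_def pre_digraph.cycle_def by auto
qed

text \<open>
  Every edge of a circuit is assigned to its start or to its end. If an edge is assigned to its end,
  then the following edge, being different, cannot be assigned to that vertex, so it is assigned to its own
  end as well. Hence either all edges are assigned to their starts and the circuit is an
  orbit, or all are assigned to their ends and the reversed circuit is an orbit. The two cases, and the two
  directions of a loop, account for the inverse of the holonomy in the conclusion.
\<close>

lemma circuit_is_orbit:
  assumes sub: "subgraph H G" and circ: "oriented_circuit H p"
  obtains r n where "r \<in> verts H" "0 < n" "(nxt ^^ n) r = r" "inj_on (\<lambda>k. (nxt ^^ k) r) {..<n}"
    "holonomy \<rho> p = (\<Prod>k<n. transport ((nxt ^^ k) r)) \<or>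
     inverse (holonomy \<rho> p) = (\<Prod>k<n. transport ((nxt ^^ k) r))"
proof -
  let ?D = "oriented_edges H"
  let ?n = "length p"
  let ?fac = "\<lambda>i. \<rho> (fst (p ! i)) powi (if snd (p ! i) then 1 else - 1)"
  interpret H: wf_digraph H using sub by auto
  have ends: "tail H = tail G" "head H = head G"
    and vH: "verts H \<subseteq> verts G" and aH: "arcs H \<subseteq> arcs G"
    using sub by (auto simp: subgraph_def compatible_def)
  from circ obtain u where "pre_digraph.awalk ?D u p u" "distinct (tl (pre_digraph.awalk_verts ?D u p))"
    and pn: "p \<noteq> []" and dist: "distinct (map fst p)"
    unfolding oriented_circuit_def pre_digraph.cycle_def by auto
  then have arcs: "set p \<subseteq> arcs ?D" and cas: "pre_digraph.cas ?D u p u"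
    and distinct_heads: "distinct (map (head ?D) p)"
    using pre_digraph.awalk_verts_conv'[of ?D u p u] by (auto simp: pre_digraph.awalk_def)
  obtain x where x: "x 0 = u" "x ?n = u" "\<And>i. i < ?n \<Longrightarrow> tail ?D (p ! i) = x i"
    "\<And>i. i < ?n \<Longrightarrow> head ?D (p ! i) = x (Suc i)"
    using cas unfolding pre_digraph.cas_iff_vertex_sequence by blast
  have inj1: "i = j" if "x (Suc i) = x (Suc j)" "i < ?n" "j < ?n" for i j
    using distinct_heads that x(4) by (metis distinct_conv_nth length_map nth_map)
  have inj0: "inj_on x {..<?n}"
  proof (rule inj_onI)
    fix i j assume ij: "i \<in> {..<?n}" "j \<in> {..<?n}" "x i = x j"
    \<comment> \<open>Only the ends of the steps are known to be distinct; the start of step \<open>i\<close> is the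
        end of the preceding step, cyclically.\<close>
    define i' where "i' = (if i = 0 then ?n - 1 else i - 1)"
    define j' where "j' = (if j = 0 then ?n - 1 else j - 1)"
    have "x (Suc i') = x (Suc j')" "i' < ?n" "j' < ?n"
      using ij x(1,2) pn by (auto simp: i'_def j'_def)
    then have "i' = j'" by (rule inj1)
    then show "i = j" using ij by (auto simp: i'_def j'_def split: if_splits)
  qed
  have b: "fst (p ! i) \<in> arcs H" if "i < ?n" for i
    using arcs nth_mem[OF that] by (auto simp: oriented_edges_def)
  have dir: "x i = (if snd (p ! i) then tail G (fst (p ! i)) else head G (fst (p ! i)))"
    "x (Suc i) = (if snd (p ! i) then head G (fst (p ! i)) else tail G (fst (p ! i)))" if "i < ?n" for i
    using x(3,4)[OF that] by (auto simp: oriented_edges_def ends case_prod_unfold)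
  have xH: "x i \<in> verts H" if "i < ?n" for i
    using dir(1)[OF that] b[OF that] by (auto simp: ends[symmetric])
  have xH': "x (Suc i) \<in> verts H" if "i < ?n" for i
    using dir(2)[OF that] b[OF that] by (auto simp: ends[symmetric])
  have loop: "?n = 1" if "x i = x (Suc i)" "i < ?n" for i
  proof (cases i)
    case 0
    then have "x (Suc (?n - 1)) = x (Suc 0)"
      using that x(1,2) pn by simp
    then show ?thesis using inj1[of "?n - 1" 0] pn by (simp add: le_Suc_eq)
  next
    case (Suc j)
    then show ?thesis using inj1[of j i] that by simp
  qed
  have forward: "nxt (x i) = x (Suc i) \<and>
      (?fac i = inverse (transport (x i)) \<or> ?n = 1 \<and> ?fac i = transport (x i))"
    if "i < ?n" "fst (p ! i) = \<sigma> (x i)" for i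
    using traverse_forward[OF dir(1)[OF that(1), symmetric, unfolded that(2)]
        dir(2)[OF that(1), symmetric, unfolded that(2)]] loop[OF _ that(1)]
    unfolding that(2) by blast
  have backward: "nxt (x (Suc i)) = x i \<and>
      (?fac i = transport (x (Suc i)) \<or> ?n = 1 \<and> ?fac i = inverse (transport (x (Suc i))))"
    if "i < ?n" "fst (p ! i) = \<sigma> (x (Suc i))" for i
    using traverse_backward[OF dir(1)[OF that(1), symmetric, unfolded that(2)]
        dir(2)[OF that(1), symmetric, unfolded that(2)]] loop[OF _ that(1)]
    unfolding that(2) by blast
  have either: "fst (p ! i) = \<sigma> (x i) \<or> fst (p ! i) = \<sigma> (x (Suc i))" if i: "i < ?n" for i
  proof -
    obtain v where v: "v \<in> verts G" "\<sigma> v = fst (p ! i)"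
      using b[OF i] aH bij by (metis bij_betw_imp_surj_on image_iff subsetD)
    have "v = x i \<or> v = x (Suc i)"
      using incident[OF v(1)] unfolding v(2) dir[OF i] by (cases "snd (p ! i)") (simp_all, blast+)
    with v(2) show ?thesis by metis
  qed
  have hol: "holonomy \<rho> p = (\<Prod>i<?n. ?fac i)"
    by (simp add: holonomy_def case_prod_unfold prod.list_conv_set_nth atLeast0LessThan)
  have back_Suc: "fst (p ! Suc i) = \<sigma> (x (Suc (Suc i)))"
    if "Suc i < ?n" "fst (p ! i) = \<sigma> (x (Suc i))" for i
    using either[OF that(1)] that dist
    by (metis Suc_lessD distinct_conv_nth length_map n_not_Suc_n nth_map)
  show thesis
  proof (cases "\<forall>i<?n. fst (p ! i) = \<sigma> (x i)")
    case True
    have orbit: "(nxt ^^ k) (x 0) = x k" if "k \<le> ?n" for k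
      using that by (induction k) (use forward True in auto)
    have "inverse (holonomy \<rho> p) = (\<Prod>k<?n. transport (x k)) \<or> holonomy \<rho> p = (\<Prod>k<?n. transport (x k))"
    proof (cases "?n = 1")
      case True
      then show ?thesis unfolding hol using forward[of 0] \<open>\<forall>i<?n. _\<close> by auto
    next
      case False
      then have "(\<Prod>i<?n. ?fac i) = (\<Prod>k<?n. inverse (transport (x k)))"
        using forward True by (intro prod.cong) auto
      then show ?thesis unfolding hol by (simp add: prod_inversef[symmetric] comp_def)
    qed
    moreover have "(\<Prod>k<?n. transport ((nxt ^^ k) (x 0))) = (\<Prod>k<?n. transport (x k))"
      using orbit by (intro prod.cong) auto
    moreover have "inj_on (\<lambda>k. (nxt ^^ k) (x 0)) {..<?n}"
      using inj0 orbit by (subst inj_on_cong[of _ _ x]) auto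
    ultimately show thesis
      using that[of "x 0" ?n] xH[of 0] pn orbit[of ?n] x(1,2) by auto
  next
    case False
    then obtain i where i: "i < ?n" "fst (p ! i) = \<sigma> (x (Suc i))"
      using either by blast
    \<comment> \<open>From step \<open>i\<close> the alternative propagates to the last step and from there, around the
        circuit, to the first.\<close>
    have up: "fst (p ! (i + k)) = \<sigma> (x (Suc (i + k)))" if "i + k < ?n" for k
      using that by (induction k) (use i back_Suc in auto)
    have "fst (p ! 0) = \<sigma> (x (Suc 0))"
    proof (rule ccontr)
      assume "fst (p ! 0) \<noteq> \<sigma> (x (Suc 0))"
      then have "fst (p ! 0) = \<sigma> (x 0)" using either[of 0] pn by auto
      moreover have "fst (p ! (?n - 1)) = \<sigma> (x 0)"
        using up[of "?n - 1 - i"] i(1) x(1,2) pn by simp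
      ultimately have "?n - 1 = 0"
        using nth_eq_iff_index_eq[OF dist, of "?n - 1" 0] pn by simp
      then have "i = 0" using i(1) by simp
      then show False
        using \<open>fst (p ! 0) \<noteq> _\<close> i(2) by simp
    qed
    then have backs: "fst (p ! k) = \<sigma> (x (Suc k))" if "k < ?n" for k
      using that by (induction k) (use back_Suc in auto)
    have orbit: "(nxt ^^ k) (x ?n) = x (?n - k)" if "k \<le> ?n" for k
      using that
    proof (induction k)
      case (Suc k)
      then have "?n - k = Suc (?n - Suc k)" by simp
      with Suc show ?case using backward[of "?n - Suc k"] backs[of "?n - Suc k"] by simp
    qed simp
    have "(\<Prod>k<?n. transport ((nxt ^^ k) (x ?n))) = (\<Prod>k<?n. transport (x (Suc (?n - Suc k))))"
      using orbit by (intro prod.cong) (auto simp: Suc_diff_Suc)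
    also have "\<dots> = (\<Prod>k<?n. transport (x (Suc k)))"
      by (rule prod.nat_diff_reindex)
    finally have prod: "(\<Prod>k<?n. transport ((nxt ^^ k) (x ?n))) = (\<Prod>k<?n. transport (x (Suc k)))" .
    have "holonomy \<rho> p = (\<Prod>k<?n. transport (x (Suc k))) \<or>
        inverse (holonomy \<rho> p) = (\<Prod>k<?n. transport (x (Suc k)))"
    proof (cases "?n = 1")
      case True
      then show ?thesis unfolding hol using backward[of 0] backs[of 0] by auto
    next
      case False
      then have "(\<Prod>i<?n. ?fac i) = (\<Prod>k<?n. transport (x (Suc k)))"
        using backward backs by (intro prod.cong) auto
      then show ?thesis unfolding hol by simp
    qed
    moreover have "inj_on (\<lambda>k. (nxt ^^ k) (x ?n)) {..<?n}"
    proof (rule inj_onI)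
      fix k l assume kl: "k \<in> {..<?n}" "l \<in> {..<?n}" "(nxt ^^ k) (x ?n) = (nxt ^^ l) (x ?n)"
      then have "x (Suc (?n - Suc k)) = x (Suc (?n - Suc l))"
        using orbit by (simp add: Suc_diff_Suc)
      then have "?n - Suc k = ?n - Suc l"
        using kl by (intro inj1) auto
      then show "k = l" using kl by auto
    qed
    ultimately show thesis
      using that[of "x ?n" ?n] xH[of 0] pn orbit[of ?n] x(1,2) prod by auto
  qed
qed

end


section \<open>The holonomy factor as a determinant\<close>

context arc_transversal
begin

lemma sigma_in_component:
  assumes "H \<in> components G" "v \<in> verts H"
  shows "\<sigma> v \<in> arcs H" "nxt v \<in> verts H"
proof -
  note sub = componentsD(1)[OF assms(1)]
  interpret H: wf_digraph H using sub by auto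
  have ends: "tail H = tail G" "head H = head G" and v: "v \<in> verts G"
    using sub assms(2) by (auto simp: subgraph_def compatible_def)
  show arc: "\<sigma> v \<in> arcs H"
    using arc_in_component[OF assms(1) sigma_in[OF v]] incident[OF v] assms(2) by auto
  then show "nxt v \<in> verts H"
    using H.tail_in_verts[OF arc] H.head_in_verts[OF arc] by (auto simp: nxt_def ends)
qed

text \<open>
  Each component has a circuit, so the choice operator in \<^const>\<open>rho_hat\<close> returns one.
\<close>

lemma chosen_circuit:
  assumes H: "H \<in> components G"
  shows "oriented_circuit H (SOME p. oriented_circuit H p)"
proof -
  note sub = componentsD(1)[OF H]
  have fin: "finite (verts H)" using sub finite_verts by (auto simp: subgraph_def intro: finite_subset)
  obtain v where v: "v \<in> verts H"
    using componentsD(2)[OF H] by (auto simp: connected_conv)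
  obtain r n where "r \<in> verts H" "0 < n" "(nxt ^^ n) r = r" "inj_on (\<lambda>k. (nxt ^^ k) r) {..<n}"
    using periodic_point_exists[where f=nxt, OF fin sigma_in_component(2)[OF H] v] by blast
  from orbit_is_circuit[OF sub sigma_in_component(1)[OF H] this] show ?thesis
    by (rule someI)
qed

text \<open>
  The set of vertices whose orbits pass through \<open>r\<close> is closed under edges in both directions: the only
  doubtful case, leaving \<open>r\<close> itself, is settled by going once around.
\<close>

lemma reaches_periodic_point:
  assumes H: "H \<in> components G" and v: "v \<in> verts H" and r: "r \<in> verts H" "0 < n" "(nxt ^^ n) r = r"
  shows "\<exists>k. (nxt ^^ k) v = r"
proof -
  note sub = componentsD(1)[OF H]
  interpret H: wf_digraph H using sub by auto
  have ends: "tail H = tail G" "head H = head G" and aH: "arcs H \<subseteq> arcs G"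
    using sub by (auto simp: subgraph_def compatible_def)
  define X where "X = {v. \<exists>k. (nxt ^^ k) v = r}"
  have step: "w \<in> X \<longleftrightarrow> nxt w \<in> X" for w
  proof
    assume "w \<in> X"
    then obtain k where "(nxt ^^ k) w = r" unfolding X_def by blast
    then have "(nxt ^^ (n + k)) w = r"
      unfolding funpow_add using r(3) by simp
    moreover obtain m where "n + k = Suc m" using r(2) by (cases "n + k") auto
    ultimately have "(nxt ^^ m) (nxt w) = r" by (simp add: funpow_swap1)
    then show "nxt w \<in> X" unfolding X_def by blast
  next
    assume "nxt w \<in> X"
    then obtain k where "(nxt ^^ k) (nxt w) = r" unfolding X_def by blast
    then have "(nxt ^^ Suc k) w = r" by (simp add: funpow_swap1)
    then show "w \<in> X" unfolding X_def by blast
  qed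
  have closed: "\<forall>c\<in>arcs H. tail H c \<in> X \<longleftrightarrow> head H c \<in> X"
  proof
    fix c assume c: "c \<in> arcs H"
    obtain w where w: "w \<in> verts G" "c = \<sigma> w"
      using c aH bij by (metis bij_betw_imp_surj_on image_iff subsetD)
    have "tail G c = w \<and> head G c = nxt w \<or> head G c = w \<and> tail G c = nxt w"
      using incident[OF w(1)] unfolding w(2) nxt_def by auto
    then show "tail H c \<in> X \<longleftrightarrow> head H c \<in> X" using step[of w] unfolding ends by metis
  qed
  have "(nxt ^^ 0) r = r" by simp
  then have "r \<in> X" unfolding X_def by blast
  with r(1) have "X \<inter> verts H \<noteq> {}" by blast
  with closed have "verts H \<subseteq> X"
    using componentsD(2)[OF H] unfolding H.connected_iff_closed by simp
  then show ?thesis using v unfolding X_def by blast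
qed

text \<open>
  As roots take the base points of the orbits belonging to the circuits chosen in \<^const>\<open>rho_hat\<close>. A
  product over components then becomes a product over roots, and the factors agree since
  \<open>(h - 1) (cnj h - 1) = \<bar>h - 1\<bar>\<^sup>2\<close> has the same value at a unit \<open>h\<close> and at its inverse.
\<close>

lemma circuit_system:
  obtains R n where "R \<subseteq> verts G" "\<And>v. v \<in> verts G \<Longrightarrow> \<exists>k. (nxt ^^ k) v \<in> R"
    "\<And>r. r \<in> R \<Longrightarrow> 0 < n r \<and> (nxt ^^ n r) r = r \<and> inj_on (\<lambda>k. (nxt ^^ k) r) {..<n r}"
    "\<And>r k. r \<in> R \<Longrightarrow> (nxt ^^ k) r \<in> R \<Longrightarrow> (nxt ^^ k) r = r"
    "rho_hat G \<rho> = (\<Prod>r\<in>R. complex_of_real ((cmod (1 - (\<Prod>k<n r. transport ((nxt ^^ k) r))))\<^sup>2))"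
proof -
  let ?hol = "\<lambda>H. holonomy \<rho> (SOME p. oriented_circuit H p)"
  let ?P = "\<lambda>r n. \<Prod>k<n. transport ((nxt ^^ k) r)"
  let ?Q = "\<lambda>H r n. r \<in> verts H \<and> 0 < n \<and> (nxt ^^ n) r = r \<and> inj_on (\<lambda>k. (nxt ^^ k) r) {..<n} \<and>
    (?hol H = ?P r n \<or> inverse (?hol H) = ?P r n)"
  have "\<exists>rn. ?Q H (fst rn) (snd rn)" if H: "H \<in> components G" for H
  proof -
    obtain r n where "?Q H r n"
      by (rule circuit_is_orbit[OF componentsD(1)[OF H] chosen_circuit[OF H]]) blast
    then show ?thesis by (intro exI[of _ "(r, n)"]) simp
  qed
  then have "\<forall>H\<in>components G. \<exists>rn. ?Q H (fst rn) (snd rn)" by blast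
  from bchoice[OF this] obtain rn where Q: "\<forall>H\<in>components G. ?Q H (fst (rn H)) (snd (rn H))" ..
  define r n where "r H = fst (rn H)" and "n H = snd (rn H)" for H
  have rn: "?Q H (r H) (n H)" if "H \<in> components G" for H
    using bspec[OF Q that] unfolding r_def n_def .
  have vG: "v \<in> verts G" if "H \<in> components G" "v \<in> verts H" for H v
    using componentsD(1)[OF that(1)] that(2) by (auto simp: subgraph_def)
  have inj: "inj_on r (components G)"
  proof (rule inj_onI)
    fix H K assume HK: "H \<in> components G" "K \<in> components G" "r H = r K"
    then have "r H \<in> verts H" "r H \<in> verts K" using rn[of H] rn[of K] by auto
    then show "H = K" by (rule components_disjoint[OF HK(1,2)])
  qed
  let ?m = "\<lambda>v. n (the_inv_into (components G) r v)"
  have m: "?m (r H) = n H" if "H \<in> components G" for H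
    using the_inv_into_f_f[OF inj that] by simp
  show thesis
  proof (rule that[of "r ` components G" ?m])
    show "r ` components G \<subseteq> verts G" using rn vG by blast
  next
    fix v assume "v \<in> verts G"
    then obtain H where H: "H \<in> components G" "v \<in> verts H" using in_some_component by blast
    then have "\<exists>k. (nxt ^^ k) v = r H"
      using reaches_periodic_point[OF H] rn[OF H(1)] by blast
    then show "\<exists>k. (nxt ^^ k) v \<in> r ` components G" using H(1) by blast
  next
    fix v assume "v \<in> r ` components G"
    then show "0 < ?m v \<and> (nxt ^^ ?m v) v = v \<and> inj_on (\<lambda>k. (nxt ^^ k) v) {..<?m v}"
      using rn m by auto
  next
    fix v k assume v: "v \<in> r ` components G" "(nxt ^^ k) v \<in> r ` components G"
    then obtain H K where H: "H \<in> components G" "v = r H" and K: "K \<in> components G" "(nxt ^^ k) v = r K"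
      by auto
    have "(nxt ^^ k) v \<in> verts H"
      using rn[OF H(1)] H(2) sigma_in_component(2)[OF H(1)] by (induction k) auto
    then have "H = K"
      using rn[OF K(1)] K(2) by (intro components_disjoint[OF H(1) K(1)]) auto
    then show "(nxt ^^ k) v = v" using H(2) K(2) by simp
  next
    have factor: "(let p = (SOME p. oriented_circuit H p) in (holonomy \<rho> p - 1) * (cnj (holonomy \<rho> p) - 1))
        = complex_of_real ((cmod (1 - ?P (r H) (n H)))\<^sup>2)" if H: "H \<in> components G" for H
    proof -
      have P: "cmod (?P (r H) (n H)) = 1"
        using rn[OF H] vG[OF H] funpow_nxt_in cmod_transport by (simp add: prod_norm[symmetric])
      have "cmod (?hol H - 1) = cmod (1 - ?P (r H) (n H))"
      proof (cases "?hol H = ?P (r H) (n H)")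
        case False
        then have inv: "inverse (?hol H) = ?P (r H) (n H)" using rn[OF H] by blast
        then have one: "cmod (?hol H) = 1"
          using P by (metis inverse_1 inverse_inverse_eq norm_inverse)
        then have "1 - inverse (?hol H) = (?hol H - 1) / ?hol H"
          using one by (cases "?hol H = 0") (simp_all add: diff_divide_distrib inverse_eq_divide)
        then show ?thesis using one unfolding inv[symmetric] by (simp add: norm_divide)
      qed (simp add: norm_minus_commute)
      moreover have "(?hol H - 1) * (cnj (?hol H) - 1) = complex_of_real ((cmod (?hol H - 1))\<^sup>2)"
        unfolding complex_norm_square by (simp only: complex_cnj_diff complex_cnj_one)
      ultimately show ?thesis by (simp only: Let_def)
    qed
    show "rho_hat G \<rho> = (\<Prod>v\<in>r ` components G.
        complex_of_real ((cmod (1 - (\<Prod>k<?m v. transport ((nxt ^^ k) v))))\<^sup>2))"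
      unfolding rho_hat_def prod.reindex[OF inj] comp_def
      by (intro prod.cong refl) (simp only: factor m)
  qed
qed

text \<open>
  If the total weight were \<open>1\<close>, the combination from \<open>cycle_combination\<close> would be a nonzero cycle.
\<close>

lemma periodic_transport_neq_1:
  assumes Z: "Z1 G \<rho> = {0}"
    and r: "r \<in> verts G" "0 < n" "(nxt ^^ n) r = r" "inj_on (\<lambda>k. (nxt ^^ k) r) {..<n}"
  shows "(\<Prod>k<n. transport ((nxt ^^ k) r)) \<noteq> 1"
proof
  assume one: "(\<Prod>k<n. transport ((nxt ^^ k) r)) = 1"
  obtain y where y: "y r = 1" "\<And>w. (\<Sum>v\<in>verts G. y v * (cell v w - transport v * cell (nxt v) w)) =
      (1 - (\<Prod>k<n. transport ((nxt ^^ k) r))) * cell r w"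
    by (rule cycle_combination[where f=nxt and u=transport, OF finite_verts nxt_in r]) blast+
  define x where "x b = (if b \<in> arcs G then (let v = the_inv_into (verts G) \<sigma> b in y v / scale v) else 0)" for b
  have inj: "inj_on \<sigma> (verts G)" using bij by (simp add: bij_betw_def)
  have nz: "scale v \<noteq> 0" if "v \<in> verts G" for v
    using cmod_scale[OF that] by auto
  have x: "x (\<sigma> v) = y v / scale v" if "v \<in> verts G" for v
    using that by (simp add: x_def sigma_in the_inv_into_f_f[OF inj] Let_def)
  have "bdry G \<rho> x w = 0" for w
  proof -
    have "bdry G \<rho> x w = (\<Sum>v\<in>verts G. x (\<sigma> v) * edge_bdry G \<rho> (\<sigma> v) w)"
      unfolding bdry_conv_edge_bdry by (rule sum.reindex_bij_betw[OF bij, symmetric])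
    also have "\<dots> = (\<Sum>v\<in>verts G. y v * (cell v w - transport v * cell (nxt v) w))"
      by (intro sum.cong refl) (simp add: x edge_bdry_sigma nz)
    finally show ?thesis using y(2) one by simp
  qed
  then have "x \<in> Z1 G \<rho>" by (auto simp: Z1_def C1_def x_def fun_eq_iff)
  then have "x (\<sigma> r) = 0" using Z by simp
  then show False using x[OF r(1)] y(1) nz[OF r(1)] by simp
qed

text \<open>
  Up to the unit factors \<open>scale\<close>, the boundary matrix is the matrix of \<open>det_on_functional\<close> for \<open>nxt\<close>,
  and its determinant consists of the factors found in \<open>circuit_system\<close>.
\<close>

theorem rho_hat_eq_det:
  shows "rho_hat G \<rho> = complex_of_real ((cmod (det_on (verts G) (\<lambda>v. edge_bdry G \<rho> (\<sigma> v))))\<^sup>2)" (is ?eq)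
    and "Z1 G \<rho> = {0} \<Longrightarrow> det_on (verts G) (\<lambda>v. edge_bdry G \<rho> (\<sigma> v)) \<noteq> 0" (is "_ \<Longrightarrow> ?D \<noteq> 0")
proof -
  obtain R n where R: "R \<subseteq> verts G" "\<And>v. v \<in> verts G \<Longrightarrow> \<exists>k. (nxt ^^ k) v \<in> R"
    "\<And>r. r \<in> R \<Longrightarrow> 0 < n r \<and> (nxt ^^ n r) r = r \<and> inj_on (\<lambda>k. (nxt ^^ k) r) {..<n r}"
    "\<And>r k. r \<in> R \<Longrightarrow> (nxt ^^ k) r \<in> R \<Longrightarrow> (nxt ^^ k) r = r"
    "rho_hat G \<rho> = (\<Prod>r\<in>R. complex_of_real ((cmod (1 - (\<Prod>k<n r. transport ((nxt ^^ k) r))))\<^sup>2))"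
    by (rule circuit_system) blast
  let ?h = "\<lambda>r. 1 - (\<Prod>k<n r. transport ((nxt ^^ k) r))"
  have "?D = (\<Prod>v\<in>verts G. scale v) * det_on (verts G) (\<lambda>v w. cell v w - transport v * cell (nxt v) w)"
    unfolding det_on_scale[symmetric] by (intro det_on_cong edge_bdry_sigma)
  also have "\<dots> = (\<Prod>v\<in>verts G. scale v) * (\<Prod>r\<in>R. ?h r)"
    by (simp only: det_on_functional[where f=nxt and u=transport, OF finite_verts nxt_in R(1-4)])
  finally have D: "?D = (\<Prod>v\<in>verts G. scale v) * (\<Prod>r\<in>R. ?h r)" .
  have one: "cmod (\<Prod>v\<in>verts G. scale v) = 1"
    by (simp add: prod_norm[symmetric] cmod_scale)
  have "cmod ?D = (\<Prod>r\<in>R. cmod (?h r))"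
    unfolding D norm_mult one by (simp add: prod_norm)
  then show ?eq
    unfolding R(5) by (simp add: prod_power_distrib)
  assume Z: "Z1 G \<rho> = {0}"
  have "?h r \<noteq> 0" if "r \<in> R" for r
    using periodic_transport_neq_1[OF Z, of r "n r"] R(1) R(3)[OF that] that by auto
  moreover have "finite R" using R(1) finite_verts by (rule finite_subset)
  ultimately have "(\<Prod>r\<in>R. ?h r) \<noteq> 0" by (simp only: prod_zero_iff) blast
  moreover have "(\<Prod>v\<in>verts G. scale v) \<noteq> 0"
    using one by (metis norm_zero zero_neq_one)
  ultimately show "?D \<noteq> 0"
    unfolding D by (simp only: mult_eq_0_iff) blast
qed

end


section \<open>Spanning trees of a line bundle as sets of edges\<close>

lemma H0_vanishes_iff: "H0_vanishes A \<rho> \<longleftrightarrow> (\<forall>y\<in>C0 A. \<exists>x\<in>C1 A. bdry A \<rho> x = y)"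
proof
  assume van: "H0_vanishes A \<rho>"
  show "\<forall>y\<in>C0 A. \<exists>x\<in>C1 A. bdry A \<rho> x = y"
  proof
    fix y assume y: "y \<in> C0 A"
    have zero: "(0 :: 'a \<Rightarrow> complex) \<in> C0 A" by (simp add: C0_def)
    have "homologous A \<rho> `` {y} \<in> H0 A \<rho>"
      unfolding H0_def using y by (rule quotientI)
    then have "homologous A \<rho> `` {y} = homologous A \<rho> `` {0}"
      using van by (simp add: H0_vanishes_def)
    then have "(y, 0) \<in> homologous A \<rho>"
      using eq_equiv_class_iff[OF equiv_homologous y zero] by simp
    then show "\<exists>x\<in>C1 A. bdry A \<rho> x = y"
      by (auto simp: homologous_def)
  qed
next
  assume surj: "\<forall>y\<in>C0 A. \<exists>x\<in>C1 A. bdry A \<rho> x = y"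
  have zero: "(0 :: 'a \<Rightarrow> complex) \<in> C0 A" by (simp add: C0_def)
  have "homologous A \<rho> `` {y} = homologous A \<rho> `` {0}" if y: "y \<in> C0 A" for y
  proof -
    obtain x where "x \<in> C1 A" "bdry A \<rho> x = y" using surj y by blast
    then have "(y, 0) \<in> homologous A \<rho>"
      using y zero by (auto simp: homologous_def)
    then show ?thesis
      using eq_equiv_class_iff[OF equiv_homologous y zero] by simp
  qed
  then have "H0 A \<rho> \<subseteq> {homologous A \<rho> `` {0}}"
    unfolding H0_def by (intro subsetI, elim quotientE) simp
  moreover have "homologous A \<rho> `` {0} \<in> H0 A \<rho>"
    unfolding H0_def using zero by (rule quotientI)
  ultimately show "H0_vanishes A \<rho>"
    unfolding H0_vanishes_def by (intro subset_antisym) simp_all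
qed

text \<open>
  As the target has a single class, bijectivity of the induced map means that the source has only one.
\<close>

lemma bij_H0_incl_iff:
  assumes sub: "subgraph T G" and fin: "finite (arcs G)" and van: "H0_vanishes G \<rho>"
  shows "bij_betw (H0_incl G \<rho>) (H0 T \<rho>) (H0 G \<rho>) \<longleftrightarrow> H0_vanishes T \<rho>"
proof -
  have zero: "(0 :: 'a \<Rightarrow> complex) \<in> C0 T" by (simp add: C0_def)
  have class0: "homologous T \<rho> `` {0} \<in> H0 T \<rho>"
    unfolding H0_def using zero by (rule quotientI)
  have img: "H0_incl G \<rho> (homologous T \<rho> `` {0}) = homologous G \<rho> `` {0}"
    by (rule H0_incl_class[OF sub fin zero])
  show ?thesis
  proof
    assume bij: "bij_betw (H0_incl G \<rho>) (H0 T \<rho>) (H0 G \<rho>)"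
    have "X = homologous T \<rho> `` {0}" if X: "X \<in> H0 T \<rho>" for X
    proof -
      have "H0_incl G \<rho> X = homologous G \<rho> `` {0}"
        using bij_betw_apply[OF bij X] van by (simp add: H0_vanishes_def)
      with img have "H0_incl G \<rho> X = H0_incl G \<rho> (homologous T \<rho> `` {0})" by (simp only:)
      with bij X class0 show ?thesis
        unfolding bij_betw_def by (blast dest: inj_onD)
    qed
    then have "H0 T \<rho> \<subseteq> {homologous T \<rho> `` {0}}" by (simp only: subset_iff singleton_iff) blast
    with class0 show "H0_vanishes T \<rho>"
      unfolding H0_vanishes_def by (intro subset_antisym) simp_all
  next
    assume "H0_vanishes T \<rho>"
    with van img show "bij_betw (H0_incl G \<rho>) (H0 T \<rho>) (H0 G \<rho>)"
      by (simp add: H0_vanishes_def bij_betw_def)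
  qed
qed

locale line_bundle_graph = fin_digraph G for G :: "('v, 'e) pre_digraph" +
  fixes \<rho> :: "'e \<Rightarrow> complex"
  assumes unit: "\<And>b. b \<in> arcs G \<Longrightarrow> cmod (\<rho> b) = 1"
    and H0: "H0_vanishes G \<rho>"
begin

definition edge_subgraph :: "'e set \<Rightarrow> ('v, 'e) pre_digraph" where
  "edge_subgraph F = G\<lparr>arcs := F\<rparr>"

text \<open>
  Spanning subgraphs are handled through their edge sets, which makes the exchange of edges a set
  operation.
\<close>

definition tree_edges :: "'e set \<Rightarrow> bool" where
  "tree_edges F \<longleftrightarrow> F \<subseteq> arcs G \<and> Z1 (edge_subgraph F) \<rho> = {0} \<and> H0_vanishes (edge_subgraph F) \<rho>"

lemma edge_subgraph_simps [simp]:
  "verts (edge_subgraph F) = verts G" "arcs (edge_subgraph F) = F"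
  "tail (edge_subgraph F) = tail G" "head (edge_subgraph F) = head G"
  by (simp_all add: edge_subgraph_def)

lemma subgraph_edge_subgraph:
  assumes "F \<subseteq> arcs G"
  shows "subgraph (edge_subgraph F) G"
proof -
  interpret F: wf_digraph "edge_subgraph F"
    using assms by unfold_locales auto
  show ?thesis
    using assms wf_digraph_axioms F.wf_digraph_axioms by (auto simp: subgraph_def compatible_def)
qed

lemma rho_spanning_tree_iff: "rho_spanning_tree G \<rho> T \<longleftrightarrow> (\<exists>F. tree_edges F \<and> T = edge_subgraph F)"
proof
  assume T: "rho_spanning_tree G \<rho> T"
  then have sub: "subgraph T G" "verts G = verts T"
    by (auto simp: rho_spanning_tree_def spanning_def)
  then have eq: "T = edge_subgraph (arcs T)"
    by (intro pre_digraph.equality) (auto simp: subgraph_def compatible_def)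
  have "tree_edges (arcs T)"
    using T sub unfolding tree_edges_def eq[symmetric]
    by (auto simp: rho_spanning_tree_def bij_H0_incl_iff[OF sub(1) finite_arcs H0] subgraph_def)
  with eq show "\<exists>F. tree_edges F \<and> T = edge_subgraph F" by blast
next
  assume "\<exists>F. tree_edges F \<and> T = edge_subgraph F"
  then show "rho_spanning_tree G \<rho> T"
    by (auto simp: tree_edges_def rho_spanning_tree_def spanning_def subgraph_edge_subgraph
        bij_H0_incl_iff[OF subgraph_edge_subgraph finite_arcs H0])
qed

lemma Z1_iff: "x \<in> Z1 G \<rho> \<longleftrightarrow>
    (\<forall>b. b \<notin> arcs G \<longrightarrow> x b = 0) \<and> (\<forall>v. (\<Sum>b\<in>arcs G. x b * edge_bdry G \<rho> b v) = 0)"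
  by (auto simp: Z1_def C1_def bdry_conv_edge_bdry fun_eq_iff)

lemma Z1_edge_subgraph:
  assumes "F \<subseteq> arcs G"
  shows "x \<in> Z1 (edge_subgraph F) \<rho> \<longleftrightarrow> x \<in> Z1 G \<rho> \<and> (\<forall>b. b \<notin> F \<longrightarrow> x b = 0)"
  using bdry_subgraph[OF subgraph_edge_subgraph[OF assms] finite_arcs, of x \<rho>] assms
  by (auto simp: Z1_def C1_def)

lemma H0_vanishes_edge_subgraph:
  assumes "F \<subseteq> arcs G"
  shows "H0_vanishes (edge_subgraph F) \<rho> \<longleftrightarrow> (\<forall>y\<in>C0 G. \<exists>x. (\<forall>b. b \<notin> F \<longrightarrow> x b = 0) \<and> bdry G \<rho> x = y)"
proof -
  have "bdry G \<rho> x = bdry (edge_subgraph F) \<rho> x" if "\<forall>b. b \<notin> F \<longrightarrow> x b = 0" for x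
    using that by (intro bdry_subgraph[OF subgraph_edge_subgraph[OF assms] finite_arcs]) (simp add: C1_def)
  then have "(\<exists>x\<in>C1 (edge_subgraph F). bdry (edge_subgraph F) \<rho> x = y) \<longleftrightarrow>
      (\<exists>x. (\<forall>b. b \<notin> F \<longrightarrow> x b = 0) \<and> bdry G \<rho> x = y)" for y
    unfolding C1_def by auto
  then show ?thesis
    unfolding H0_vanishes_iff by (simp add: C0_def)
qed

lemma Z1_sum:
  assumes "\<And>i. i \<in> I \<Longrightarrow> t i \<in> Z1 G \<rho>"
  shows "(\<lambda>e. \<Sum>i\<in>I. c i * t i e) \<in> Z1 G \<rho>"
  unfolding Z1_iff
proof (intro conjI allI impI)
  fix b assume "b \<notin> arcs G"
  then show "(\<Sum>i\<in>I. c i * t i b) = 0"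
    using assms by (auto simp: Z1_iff intro!: sum.neutral)
next
  fix v
  have "(\<Sum>b\<in>arcs G. (\<Sum>i\<in>I. c i * t i b) * edge_bdry G \<rho> b v)
      = (\<Sum>i\<in>I. c i * (\<Sum>b\<in>arcs G. t i b * edge_bdry G \<rho> b v))"
    unfolding sum_distrib_right sum_distrib_left by (subst sum.swap) (simp add: mult_ac)
  then show "(\<Sum>b\<in>arcs G. (\<Sum>i\<in>I. c i * t i b) * edge_bdry G \<rho> b v) = 0"
    using assms by (simp add: Z1_iff)
qed

lemma bdry_diff_scaled: "bdry G \<rho> (\<lambda>e. x e - c * y e) = (\<lambda>v. bdry G \<rho> x v - c * bdry G \<rho> y v)"
  by (simp add: fun_eq_iff bdry_conv_edge_bdry sum_subtractf sum_distrib_left algebra_simps)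

lemma bdry_cell: "b \<in> arcs G \<Longrightarrow> bdry G \<rho> (cell b) = edge_bdry G \<rho> b"
  by (simp add: fun_eq_iff bdry_conv_edge_bdry cell_def if_distrib[of "\<lambda>t. t * _"] cong: if_cong)

lemma edge_bdry_C0: "b \<in> arcs G \<Longrightarrow> edge_bdry G \<rho> b \<in> C0 G"
  by (auto simp: C0_def edge_bdry_def cell_def)

lemma Z1_diff_scaled:
  "x \<in> Z1 G \<rho> \<Longrightarrow> y \<in> Z1 G \<rho> \<Longrightarrow> (\<lambda>e. x e - c * y e) \<in> Z1 G \<rho>"
  by (auto simp: Z1_def C1_def bdry_diff_scaled fun_eq_iff)

lemma tree_edgesD:
  assumes "tree_edges F"
  shows "F \<subseteq> arcs G" "\<And>x. \<lbrakk>x \<in> Z1 G \<rho>; \<And>b. b \<notin> F \<Longrightarrow> x b = 0\<rbrakk> \<Longrightarrow> x e = 0"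
    "\<And>y. y \<in> C0 G \<Longrightarrow> \<exists>x. (\<forall>b. b \<notin> F \<longrightarrow> x b = 0) \<and> bdry G \<rho> x = y"
proof -
  show F: "F \<subseteq> arcs G" using assms by (simp add: tree_edges_def)
  show "x e = 0" if "x \<in> Z1 G \<rho>" "\<And>b. b \<notin> F \<Longrightarrow> x b = 0" for x
  proof -
    have "x \<in> Z1 (edge_subgraph F) \<rho>" using that by (simp add: Z1_edge_subgraph[OF F])
    then show ?thesis using assms by (simp add: tree_edges_def)
  qed
  show "\<exists>x. (\<forall>b. b \<notin> F \<longrightarrow> x b = 0) \<and> bdry G \<rho> x = y" if "y \<in> C0 G" for y
    using assms that by (simp add: tree_edges_def H0_vanishes_edge_subgraph[OF F])
qed

lemma tree_edgesI:
  assumes F: "F \<subseteq> arcs G" and "\<And>x e. \<lbrakk>x \<in> Z1 G \<rho>; \<And>b. b \<notin> F \<Longrightarrow> x b = 0\<rbrakk> \<Longrightarrow> x e = 0"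
    "\<And>y. y \<in> C0 G \<Longrightarrow> \<exists>x. (\<forall>b. b \<notin> F \<longrightarrow> x b = 0) \<and> bdry G \<rho> x = y"
  shows "tree_edges F"
proof -
  have "x = 0" if "x \<in> Z1 (edge_subgraph F) \<rho>" for x
    using assms(2)[of x] that by (auto simp: Z1_edge_subgraph[OF F] fun_eq_iff)
  moreover have "0 \<in> Z1 (edge_subgraph F) \<rho>" by (auto simp: Z1_def C1_def bdry_def fun_eq_iff)
  ultimately show ?thesis
    unfolding tree_edges_def using F assms(3) by (auto simp: H0_vanishes_edge_subgraph[OF F])
qed

text \<open>
  A largest set of edges without nonzero cycles will do: the boundary of any further edge is a
  combination of boundaries from the set, since adding this edge creates a cycle.
\<close>

lemma tree_edges_exist: "\<exists>F. tree_edges F"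
proof -
  define P where "P F \<longleftrightarrow> F \<subseteq> arcs G \<and>
    (\<forall>x. x \<in> Z1 G \<rho> \<longrightarrow> (\<forall>b. b \<notin> F \<longrightarrow> x b = 0) \<longrightarrow> (\<forall>e. x e = 0))" for F
  have "P {}" by (simp add: P_def)
  moreover have "\<forall>F. P F \<longrightarrow> card F < Suc (card (arcs G))"
    by (auto simp: P_def less_Suc_eq_le intro: card_mono)
  ultimately have "\<exists>F. P F \<and> (\<forall>F'. P F' \<longrightarrow> card F' \<le> card F)"
    by (rule ex_has_greatest_nat)
  then obtain F where PF: "P F" and max: "\<And>F'. P F' \<Longrightarrow> card F' \<le> card F" by blast
  from PF have F: "F \<subseteq> arcs G" by (simp add: P_def)
  have indep: "x e = 0" if "x \<in> Z1 G \<rho>" "\<And>b. b \<notin> F \<Longrightarrow> x b = 0" for x e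
    using PF that unfolding P_def by blast
  have fin: "finite F" using F finite_arcs by (rule finite_subset)
  have "\<exists>x. (\<forall>a. a \<notin> F \<longrightarrow> x a = 0) \<and> bdry G \<rho> x = edge_bdry G \<rho> b" if b: "b \<in> arcs G" for b
  proof (cases "b \<in> F")
    case True
    then show ?thesis using bdry_cell[OF b] by (intro exI[of _ "cell b"]) (auto simp: cell_def)
  next
    case False
    then have "\<not> P (insert b F)" using max[of "insert b F"] fin by auto
    then obtain x e where x: "x \<in> Z1 G \<rho>" "\<forall>a. a \<notin> insert b F \<longrightarrow> x a = 0" "x e \<noteq> 0"
      using F b unfolding P_def by blast
    have nz: "x b \<noteq> 0"
    proof
      assume "x b = 0"
      then have "x a = 0" if "a \<notin> F" for a using x(2) that by (cases "a = b") auto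
      then have "x e = 0" by (rule indep[OF x(1)])
      with x(3) show False by simp
    qed
    define y where "y a = cell b a - 1 / x b * x a" for a
    have "\<forall>a. a \<notin> F \<longrightarrow> y a = 0" using x(2) nz by (auto simp: y_def cell_def)
    moreover have "bdry G \<rho> y = edge_bdry G \<rho> b"
      unfolding y_def bdry_diff_scaled bdry_cell[OF b] using x(1) by (simp add: Z1_def fun_eq_iff)
    ultimately show ?thesis by blast
  qed
  then have "\<forall>b\<in>arcs G. \<exists>x. (\<forall>a. a \<notin> F \<longrightarrow> x a = 0) \<and> bdry G \<rho> x = edge_bdry G \<rho> b" by blast
  from bchoice[OF this] obtain s where s: "\<And>b a. b \<in> arcs G \<Longrightarrow> a \<notin> F \<Longrightarrow> s b a = 0"
    "\<And>b. b \<in> arcs G \<Longrightarrow> bdry G \<rho> (s b) = edge_bdry G \<rho> b" by blast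
  have span: "\<exists>x. (\<forall>b. b \<notin> F \<longrightarrow> x b = 0) \<and> bdry G \<rho> x = y" if y: "y \<in> C0 G" for y
  proof -
    obtain z where z: "bdry G \<rho> z = y" using H0 y unfolding H0_vanishes_iff by blast
    define x where "x a = (\<Sum>b\<in>arcs G. z b * s b a)" for a
    have "bdry G \<rho> x v = y v" for v
    proof -
      have "bdry G \<rho> x v = (\<Sum>b\<in>arcs G. z b * bdry G \<rho> (s b) v)"
        unfolding bdry_conv_edge_bdry x_def sum_distrib_right sum_distrib_left
        by (subst sum.swap) (simp add: mult_ac)
      also have "\<dots> = bdry G \<rho> z v"
        by (simp add: s(2)) (simp add: bdry_conv_edge_bdry)
      finally show ?thesis using z by simp
    qed
    moreover have "\<forall>b. b \<notin> F \<longrightarrow> x b = 0" using s(1) by (simp add: x_def)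
    ultimately show ?thesis by blast
  qed
  have "tree_edges F"
  proof (rule tree_edgesI)
    show "x e = 0" if "x \<in> Z1 G \<rho>" "\<And>b. b \<notin> F \<Longrightarrow> x b = 0" for x e
      using that by (rule indep)
  qed (use F span in auto)
  then show ?thesis by (rule exI)
qed

definition fundamental_cycle :: "'e set \<Rightarrow> 'e \<Rightarrow> 'e \<Rightarrow> complex" where
  "fundamental_cycle F b = Tbar_edge G \<rho> (edge_subgraph F) b"

lemma fundamental_cycle_in: "b \<in> F \<Longrightarrow> fundamental_cycle F b e = 0"
  by (simp add: fundamental_cycle_def Tbar_edge_def)

text \<open>
  The boundary of \<open>b\<close> is the boundary of a chain on the tree, so there is a nonzero cycle on the tree
  and \<open>b\<close>. Its coefficient at \<open>b\<close> is nonzero as the tree carries no cycle; hence the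
  normalization in \<^const>\<open>Tbar_edge\<close> divides by a nonzero number.
\<close>

lemma fundamental_cycle_not_in:
  assumes F: "tree_edges F" and b: "b \<in> arcs G" "b \<notin> F"
  shows "fundamental_cycle F b \<in> Z1 G \<rho>" "fundamental_cycle F b b = 1"
    "\<And>e. e \<noteq> b \<Longrightarrow> e \<notin> F \<Longrightarrow> fundamental_cycle F b e = 0"
proof -
  let ?A = "pre_digraph.add_arc (edge_subgraph F) b"
  note FG = tree_edgesD(1)[OF F]
  have ZA: "x \<in> H1 ?A \<rho> \<longleftrightarrow> x \<in> Z1 G \<rho> \<and> (\<forall>a. a \<notin> insert b F \<longrightarrow> x a = 0)" for x
  proof -
    have "x \<in> H1 ?A \<rho> \<longleftrightarrow> x \<in> Z1 (edge_subgraph (insert b F)) \<rho>"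
      by (simp add: Z1_def C1_def bdry_def pre_digraph.add_arc_def)
    then show ?thesis using Z1_edge_subgraph[of "insert b F" x] FG b(1) by simp
  qed
  obtain x where x: "\<forall>a. a \<notin> F \<longrightarrow> x a = 0" "bdry G \<rho> x = edge_bdry G \<rho> b"
    using tree_edgesD(3)[OF F edge_bdry_C0[OF b(1)]] by blast
  define y where "y a = cell b a - 1 * x a" for a
  have "bdry G \<rho> y = 0"
    unfolding y_def bdry_diff_scaled bdry_cell[OF b(1)] x(2) by (simp add: fun_eq_iff)
  moreover have supp: "\<forall>a. a \<notin> insert b F \<longrightarrow> y a = 0" using x(1) by (auto simp: y_def cell_def)
  ultimately have "y \<in> H1 ?A \<rho>"
    unfolding ZA using FG b(1) by (auto simp: Z1_def C1_def)
  moreover have "y b = 1" using x(1) b(2) by (simp add: y_def cell_def)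
  then have "y \<noteq> 0" by auto
  ultimately have "\<exists>c. c \<in> H1 ?A \<rho> \<and> c \<noteq> 0" by blast
  then have "(SOME c. c \<in> H1 ?A \<rho> \<and> c \<noteq> 0) \<in> H1 ?A \<rho> \<and> (SOME c. c \<in> H1 ?A \<rho> \<and> c \<noteq> 0) \<noteq> 0"
    by (rule someI_ex)
  then obtain c where c: "c = (SOME c. c \<in> H1 ?A \<rho> \<and> c \<noteq> 0)" "c \<in> H1 ?A \<rho>" "c \<noteq> 0" by blast
  have nz: "c b \<noteq> 0"
  proof
    assume "c b = 0"
    with c(2) have "c \<in> Z1 G \<rho>" "\<And>a. a \<notin> F \<Longrightarrow> c a = 0" unfolding ZA by (blast, metis insertE)
    then have "c e = 0" for e by (rule tree_edgesD(2)[OF F])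
    with c(3) show False by (auto simp: fun_eq_iff)
  qed
  have "chain_inner G c (cell b) = c b"
    using b(1) by (simp add: chain_inner_def cell_def if_distrib[of cnj] if_distrib[of "\<lambda>t. _ * t"] cong: if_cong)
  then have fc: "fundamental_cycle F b = (\<lambda>e. c e / c b)"
    using b(2) by (simp add: fundamental_cycle_def Tbar_edge_def c(1)[symmetric] Let_def)
  show "fundamental_cycle F b b = 1" using nz by (simp add: fc)
  show "fundamental_cycle F b e = 0" if "e \<noteq> b" "e \<notin> F" for e
    using c(2) that unfolding ZA fc by simp
  have "(\<lambda>e. \<Sum>i\<in>{()}. 1 / c b * c e) \<in> Z1 G \<rho>"
    by (rule Z1_sum) (use c(2) ZA in blast)
  then show "fundamental_cycle F b \<in> Z1 G \<rho>" by (simp add: fc)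
qed

lemma fundamental_cycle_Z1: "tree_edges F \<Longrightarrow> b \<in> arcs G \<Longrightarrow> fundamental_cycle F b \<in> Z1 G \<rho>"
  using fundamental_cycle_not_in(1)[of F b]
  by (cases "b \<in> F") (auto simp: fundamental_cycle_in Z1_iff)

lemma fundamental_cycle_unique:
  assumes F: "tree_edges F" and b: "b \<in> arcs G" "b \<notin> F"
    and t: "t \<in> Z1 G \<rho>" "t b = 1" "\<And>e. e \<noteq> b \<Longrightarrow> e \<notin> F \<Longrightarrow> t e = 0"
  shows "fundamental_cycle F b e = t e"
proof -
  have "t e - 1 * fundamental_cycle F b e = 0"
  proof (rule tree_edgesD(2)[OF F Z1_diff_scaled[OF t(1) fundamental_cycle_not_in(1)[OF F b]]])
    fix a assume "a \<notin> F"
    then show "t a - 1 * fundamental_cycle F b a = 0"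
      using t(2) t(3)[of a] fundamental_cycle_not_in(2,3)[OF F b] by (cases "a = b") auto
  qed
  then show ?thesis by simp
qed

text \<open>
  \<open>T\<close>-bar fixes cycles: both sides have the same coefficients off the tree, and the difference is a
  cycle on the tree.
\<close>

lemma cycle_eq_sum_fundamental_cycles:
  assumes F: "tree_edges F" and z: "z \<in> Z1 G \<rho>"
  shows "(\<Sum>b\<in>arcs G. z b * fundamental_cycle F b e) = z e"
proof -
  let ?s = "\<lambda>e. \<Sum>b\<in>arcs G. z b * fundamental_cycle F b e"
  have "?s a = z a" if a: "a \<notin> F" for a
  proof (cases "a \<in> arcs G")
    case True
    have "z b * fundamental_cycle F b a = (if b = a then z a else 0)" if "b \<in> arcs G" for b
      using fundamental_cycle_not_in[OF F that] fundamental_cycle_in[of b F a] a by (cases "b \<in> F") auto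
    then have "?s a = (\<Sum>b\<in>arcs G. if b = a then z a else 0)" by (intro sum.cong) auto
    also have "\<dots> = z a" using True by simp
    finally show ?thesis .
  next
    case False
    then show ?thesis
      using z fundamental_cycle_Z1[OF F] by (auto simp: Z1_iff intro!: sum.neutral)
  qed
  then have off: "?s a - 1 * z a = 0" if "a \<notin> F" for a using that by simp
  have "?s \<in> Z1 G \<rho>" by (intro Z1_sum fundamental_cycle_Z1[OF F])
  from tree_edgesD(2)[OF F Z1_diff_scaled[OF this z, where c=1] off] have "?s e - 1 * z e = 0" .
  then show ?thesis by simp
qed


section \<open>The exchange of an edge in a spanning tree\<close>

text \<open>
  The boundary operator of a tree is an invertible matrix; its nonzero entries occur only where edge and
  vertex are incident.
\<close>

lemma transversal_exists:
  assumes F: "tree_edges F"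
  obtains \<sigma> where "arc_transversal (edge_subgraph F) \<rho> \<sigma>"
proof -
  note FG = tree_edgesD(1)[OF F]
  have eqF: "(\<Sum>b\<in>F. x b * edge_bdry G \<rho> b v) = bdry G \<rho> x v" if "\<forall>b. b \<notin> F \<longrightarrow> x b = 0" for x v
    unfolding bdry_conv_edge_bdry using FG that by (intro sum.mono_neutral_left) auto
  have off: "bdry G \<rho> x v = 0" if "v \<notin> verts G" for x v
    using that by (auto simp: bdry_conv_edge_bdry edge_bdry_def cell_def intro!: sum.neutral)
  have "\<exists>\<sigma>. bij_betw \<sigma> (verts G) F \<and> (\<forall>v\<in>verts G. edge_bdry G \<rho> (\<sigma> v) v \<noteq> 0)"
  proof (rule transversal_of_invertible)
    show "finite (verts G)" "finite F" using FG finite_arcs by (auto intro: finite_subset)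
  next
    fix x assume x: "\<forall>b. b \<notin> F \<longrightarrow> x b = 0" "\<forall>v\<in>verts G. (\<Sum>b\<in>F. x b * edge_bdry G \<rho> b v) = 0"
    then have "bdry G \<rho> x v = 0" for v using eqF[OF x(1)] off by metis
    then have "x \<in> Z1 G \<rho>" using x(1) FG by (auto simp: Z1_def C1_def fun_eq_iff)
    then show "\<forall>b. x b = 0" using tree_edgesD(2)[OF F, of x] x(1) by blast
  next
    fix y :: "'v \<Rightarrow> complex"
    have "(\<lambda>v. if v \<in> verts G then y v else 0) \<in> C0 G" by (simp add: C0_def)
    then obtain x where x: "\<forall>b. b \<notin> F \<longrightarrow> x b = 0" "bdry G \<rho> x = (\<lambda>v. if v \<in> verts G then y v else 0)"
      using tree_edgesD(3)[OF F] by blast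
    then show "\<exists>x. (\<forall>b. b \<notin> F \<longrightarrow> x b = 0) \<and> (\<forall>v\<in>verts G. (\<Sum>b\<in>F. x b * edge_bdry G \<rho> b v) = y v)"
      using eqF[OF x(1)] by (intro exI[of _ x]) auto
  qed
  then obtain \<sigma> where \<sigma>: "bij_betw \<sigma> (verts G) F" "\<And>v. v \<in> verts G \<Longrightarrow> edge_bdry G \<rho> (\<sigma> v) v \<noteq> 0"
    by blast
  interpret F: fin_digraph "edge_subgraph F"
    by (rule fin_digraph_subgraph[OF subgraph_edge_subgraph[OF FG]])
  have "arc_transversal (edge_subgraph F) \<rho> \<sigma>"
  proof unfold_locales
    fix v assume "v \<in> verts (edge_subgraph F)"
    then have "edge_bdry G \<rho> (\<sigma> v) v \<noteq> 0" using \<sigma>(2) by simp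
    then show "tail (edge_subgraph F) (\<sigma> v) = v \<or> head (edge_subgraph F) (\<sigma> v) = v"
      by (auto simp: edge_bdry_def cell_def split: if_splits)
  qed (use \<sigma> FG unit in auto)
  then show thesis by (rule that)
qed

lemma edge_bdry_edge_subgraph [simp]: "edge_bdry (edge_subgraph F) \<rho> = edge_bdry G \<rho>"
  by (simp add: fun_eq_iff edge_bdry_def)

text \<open>
  The matching \<open>\<sigma>\<close> of vertices with tree edges need not respect incidence. This freedom is what the
  exchange needs, where an incident matching of one tree is altered at one vertex.
\<close>

lemma rho_hat_tree_eq_det:
  assumes F: "tree_edges F" and \<sigma>: "bij_betw \<sigma> (verts G) F"
  shows "rho_hat (edge_subgraph F) \<rho> =
    complex_of_real ((cmod (det_on (verts G) (\<lambda>v. edge_bdry G \<rho> (\<sigma> v))))\<^sup>2)"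
proof -
  obtain \<tau> where "arc_transversal (edge_subgraph F) \<rho> \<tau>" by (rule transversal_exists[OF F])
  then interpret \<tau>: arc_transversal "edge_subgraph F" \<rho> \<tau> .
  show ?thesis
    using \<tau>.rho_hat_eq_det(1) cmod_det_on_bij_eq[OF finite_verts \<sigma>, of \<tau> "edge_bdry G \<rho>"] \<tau>.bij
    by simp
qed

lemma rho_hat_tree_pos:
  assumes F: "tree_edges F"
  shows "\<exists>h>0. rho_hat (edge_subgraph F) \<rho> = complex_of_real h"
proof -
  obtain \<tau> where "arc_transversal (edge_subgraph F) \<rho> \<tau>" by (rule transversal_exists[OF F])
  then interpret \<tau>: arc_transversal "edge_subgraph F" \<rho> \<tau> .
  show ?thesis
    using \<tau>.rho_hat_eq_det F
    by (intro exI[of _ "(cmod (det_on (verts G) (\<lambda>v. edge_bdry G \<rho> (\<tau> v))))\<^sup>2"])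
       (simp add: tree_edges_def)
qed

text \<open>
  Since the fundamental cycle \<open>t\<close> of \<open>b\<close> has nonzero coefficients at \<open>b\<close> and at \<open>e\<close>, subtracting
  multiples of \<open>t\<close> translates chains on \<open>F\<close> into chains on \<open>F'\<close> and back. The relation \<open>\<partial>t = 0\<close> expresses
  the boundary of \<open>b\<close> by those of the edges of \<open>F\<close>, with coefficient \<open>- t e\<close> at \<open>e\<close>, so the
  determinant changes by this factor.
\<close>

lemma exchange:
  assumes F: "tree_edges F" and b: "b \<in> arcs G" "b \<notin> F" and e: "e \<in> F"
    and nz: "fundamental_cycle F b e \<noteq> 0"
  defines "F' \<equiv> insert b (F - {e})"
  shows "tree_edges F'"
    "\<And>a. fundamental_cycle F' e a = fundamental_cycle F b a / fundamental_cycle F b e"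
    "rho_hat (edge_subgraph F') \<rho>
      = complex_of_real ((cmod (fundamental_cycle F b e))\<^sup>2) * rho_hat (edge_subgraph F) \<rho>"
proof -
  let ?t = "fundamental_cycle F b"
  note FG = tree_edgesD(1)[OF F]
  note t = fundamental_cycle_not_in[OF F b]
  have eb: "e \<noteq> b" using b e by auto
  show tree: "tree_edges F'"
  proof (rule tree_edgesI)
    show "F' \<subseteq> arcs G" using FG b by (auto simp: F'_def)
  next
    fix x a assume x: "x \<in> Z1 G \<rho>" "\<And>a. a \<notin> F' \<Longrightarrow> x a = 0"
    have eq: "x a - x b * ?t a = 0" for a
    proof (rule tree_edgesD(2)[OF F Z1_diff_scaled[OF x(1) t(1)]])
      fix a assume "a \<notin> F"
      then show "x a - x b * ?t a = 0" using x(2)[of a] t(2,3) by (cases "a = b") (auto simp: F'_def)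
    qed
    have "x b = 0" using eq[of e] x(2)[of e] nz eb by (simp add: F'_def)
    then show "x a = 0" using eq[of a] by simp
  next
    fix y assume "y \<in> C0 G"
    then obtain x where x: "\<forall>a. a \<notin> F \<longrightarrow> x a = 0" "bdry G \<rho> x = y"
      using tree_edgesD(3)[OF F] by blast
    define x' where "x' a = x a - x e / ?t e * ?t a" for a
    have "\<forall>a. a \<notin> F' \<longrightarrow> x' a = 0"
      using x(1) t(3) nz by (auto simp: F'_def x'_def)
    moreover have "bdry G \<rho> x' = y"
      unfolding x'_def bdry_diff_scaled x(2) using t(1) by (simp add: Z1_def)
    ultimately show "\<exists>x. (\<forall>b. b \<notin> F' \<longrightarrow> x b = 0) \<and> bdry G \<rho> x = y" by blast
  qed
  show "fundamental_cycle F' e a = ?t a / ?t e" for a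
  proof (rule fundamental_cycle_unique[OF tree])
    have "(\<lambda>a. \<Sum>i\<in>{()}. 1 / ?t e * ?t a) \<in> Z1 G \<rho>"
      by (rule Z1_sum) (rule t(1))
    then show "(\<lambda>a. ?t a / ?t e) \<in> Z1 G \<rho>" by simp
  qed (use e FG eb nz t(3) in \<open>auto simp: F'_def\<close>)
  obtain \<sigma> where "arc_transversal (edge_subgraph F) \<rho> \<sigma>" by (rule transversal_exists[OF F])
  then have \<sigma>: "bij_betw \<sigma> (verts G) F" by (simp add: arc_transversal_def arc_transversal_axioms_def)
  obtain v where v: "v \<in> verts G" "\<sigma> v = e"
    using \<sigma> e by (auto simp: bij_betw_def)
  have "bij_betw \<sigma> (verts G - {v}) (F - {e})"
    using bij_betw_DiffI[OF \<sigma>, of "{v}" "{e}"] v e by (simp add: bij_betw_def)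
  then have "bij_betw (\<sigma>(v := b)) (verts G - {v}) (F - {e})"
    by (subst bij_betw_cong[of _ _ \<sigma>]) auto
  then have "bij_betw (\<sigma>(v := b)) (verts G - {v} \<union> {v}) (F - {e} \<union> {b})"
    using b(2) by (intro bij_betw_combine) (auto simp: bij_betw_def)
  then have \<sigma>': "bij_betw (\<sigma>(v := b)) (verts G) F'"
    using v(1) by (simp add: F'_def insert_absorb)
  have comb: "edge_bdry G \<rho> b w = (\<Sum>u\<in>verts G. - ?t (\<sigma> u) * edge_bdry G \<rho> (\<sigma> u) w)" for w
  proof -
    have "0 = (\<Sum>a\<in>arcs G. ?t a * edge_bdry G \<rho> a w)" using t(1) by (simp add: Z1_iff)
    also have "\<dots> = (\<Sum>a\<in>insert b F. ?t a * edge_bdry G \<rho> a w)"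
      using FG b t(3) by (intro sum.mono_neutral_right) auto
    also have "\<dots> = edge_bdry G \<rho> b w + (\<Sum>a\<in>F. ?t a * edge_bdry G \<rho> a w)"
      using b t(2) finite_subset[OF FG finite_arcs] by simp
    also have "(\<Sum>a\<in>F. ?t a * edge_bdry G \<rho> a w) = (\<Sum>u\<in>verts G. ?t (\<sigma> u) * edge_bdry G \<rho> (\<sigma> u) w)"
      by (rule sum.reindex_bij_betw[OF \<sigma>, symmetric])
    finally show ?thesis by (simp add: sum_negf eq_neg_iff_add_eq_0)
  qed
  let ?A = "\<lambda>u. edge_bdry G \<rho> (\<sigma> u)"
  have "(\<lambda>u. edge_bdry G \<rho> ((\<sigma>(v := b)) u)) = ?A(v := \<lambda>w. \<Sum>u\<in>verts G. - ?t (\<sigma> u) * ?A u w)"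
    unfolding comb[symmetric] by (auto simp: fun_eq_iff)
  then have "det_on (verts G) (\<lambda>u. edge_bdry G \<rho> ((\<sigma>(v := b)) u)) = - ?t e * det_on (verts G) ?A"
    using det_on_combine_rows[OF finite_verts v(1), of ?A "\<lambda>u. - ?t (\<sigma> u)"] v(2) by simp
  then show "rho_hat (edge_subgraph F') \<rho>
      = complex_of_real ((cmod (?t e))\<^sup>2) * rho_hat (edge_subgraph F) \<rho>"
    unfolding rho_hat_tree_eq_det[OF tree \<sigma>'] rho_hat_tree_eq_det[OF F \<sigma>]
    by (simp add: norm_mult power_mult_distrib)
qed

end


section \<open>The weighted average over the spanning trees\<close>

locale resistor_network = line_bundle_graph G \<rho>
  for G :: "('v, 'e) pre_digraph" and \<rho> :: "'e \<Rightarrow> complex" +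
  fixes r :: "'e \<Rightarrow> real"
  assumes pos: "\<And>b. b \<in> arcs G \<Longrightarrow> r b > 0"
begin

abbreviation tree_weight :: "'e set \<Rightarrow> complex" where
  "tree_weight F \<equiv> weight \<rho> r (edge_subgraph F)"

definition total_weight :: complex where
  "total_weight = (\<Sum>F | tree_edges F. tree_weight F)"

text \<open>
  Up to the factor \<open>total_weight\<close>, this is the image of the edge \<open>b\<close> under the projection onto the
  cycles that is orthogonal with respect to the resistances.
\<close>

definition weighted_cycle :: "'e \<Rightarrow> 'e \<Rightarrow> complex" where
  "weighted_cycle b e = (\<Sum>F | tree_edges F. tree_weight F * fundamental_cycle F b e)"

lemma finite_tree_edges: "finite {F. tree_edges F}"
  by (rule finite_subset[of _ "Pow (arcs G)"]) (auto simp: tree_edges_def)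

lemma tree_weight_pos:
  assumes F: "tree_edges F"
  shows "\<exists>w>0. tree_weight F = complex_of_real w"
proof -
  obtain h where h: "h > 0" "rho_hat (edge_subgraph F) \<rho> = complex_of_real h"
    using rho_hat_tree_pos[OF F] by blast
  have "(\<Prod>b\<in>F. inverse (r b)) > 0"
    using tree_edgesD(1)[OF F] pos by (intro prod_pos) auto
  with h show ?thesis
    by (intro exI[of _ "h * (\<Prod>b\<in>F. inverse (r b))"]) (simp add: weight_def)
qed

lemma cnj_tree_weight: "tree_edges F \<Longrightarrow> cnj (tree_weight F) = tree_weight F"
  using tree_weight_pos[of F] by auto

lemma total_weight_pos: "\<exists>w>0. total_weight = complex_of_real w"
proof -
  have "\<forall>F\<in>{F. tree_edges F}. \<exists>w>0. tree_weight F = complex_of_real w"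
    using tree_weight_pos by simp
  from bchoice[OF this] obtain w where w: "\<And>F. tree_edges F \<Longrightarrow> w F > 0"
    "\<And>F. tree_edges F \<Longrightarrow> tree_weight F = complex_of_real (w F)" by auto
  have "(\<Sum>F | tree_edges F. w F) > 0"
    using w(1) tree_edges_exist finite_tree_edges by (intro sum_pos) auto
  moreover have "total_weight = complex_of_real (\<Sum>F | tree_edges F. w F)"
    unfolding total_weight_def of_real_sum by (intro sum.cong) (auto simp: w(2))
  ultimately show ?thesis by blast
qed

text \<open>
  Passing from \<open>F\<close> to \<open>F'\<close> multiplies the weight by \<open>\<bar>a\<bar>\<^sup>2 r\<^sub>e / r\<^sub>b\<close>, where \<open>a\<close> is the coefficient of
  the fundamental cycle at \<open>e\<close>, and replaces this coefficient by \<open>1 / a\<close>.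
\<close>

lemma exchange_weight:
  assumes F: "tree_edges F" and b: "b \<in> arcs G" "b \<notin> F" and e: "e \<in> F"
    and nz: "fundamental_cycle F b e \<noteq> 0"
  defines "F' \<equiv> insert b (F - {e})"
  shows "complex_of_real (r e) * (tree_weight F * fundamental_cycle F b e)
    = complex_of_real (r b) * cnj (tree_weight F' * fundamental_cycle F' e b)"
proof -
  let ?a = "fundamental_cycle F b e"
  note ex = exchange[OF F b e nz, folded F'_def]
  let ?P = "\<Prod>a\<in>F - {e}. inverse (complex_of_real (r a))"
  have fin: "finite F" using tree_edgesD(1)[OF F] finite_arcs by (rule finite_subset)
  have re: "r e \<noteq> 0" and rb: "r b \<noteq> 0"
    using pos[of e] pos[of b] tree_edgesD(1)[OF F] e b by auto
  have wF: "tree_weight F = rho_hat (edge_subgraph F) \<rho> * (inverse (complex_of_real (r e)) * ?P)"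
    using fin e by (simp add: weight_def prod.remove[of F e])
  have wF': "tree_weight F' = complex_of_real ((cmod ?a)\<^sup>2) * rho_hat (edge_subgraph F) \<rho> *
      (inverse (complex_of_real (r b)) * ?P)"
    using fin b e by (simp add: weight_def ex(3)) (simp add: F'_def)
  have cyc: "fundamental_cycle F' e b = 1 / ?a"
    using ex(2)[of b] fundamental_cycle_not_in(2)[OF F b] by simp
  have conj: "cnj (tree_weight F' * fundamental_cycle F' e b) = tree_weight F' / cnj ?a"
    by (simp add: cyc cnj_tree_weight[OF ex(1)])
  show ?thesis
    unfolding conj unfolding wF wF' complex_norm_square using re rb nz by (simp add: field_simps)
qed

text \<open>
  Self-adjointness of the projection. For \<open>b = e\<close> all coefficients are \<open>0\<close> or \<open>1\<close>; otherwise
  exchanging \<open>e\<close> for \<open>b\<close> is a bijection between the trees contributing to the two sides.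
\<close>

lemma weighted_cycle_hermitian:
  assumes b: "b \<in> arcs G" and e: "e \<in> arcs G"
  shows "complex_of_real (r e) * weighted_cycle b e = complex_of_real (r b) * cnj (weighted_cycle e b)"
proof (cases "b = e")
  case True
  have "cnj (tree_weight F * fundamental_cycle F b b) = tree_weight F * fundamental_cycle F b b"
    if F: "tree_edges F" for F
    using cnj_tree_weight[OF F] fundamental_cycle_not_in(2)[OF F b] fundamental_cycle_in[of b F b]
    by (cases "b \<in> F") auto
  then have "cnj (weighted_cycle b b) = weighted_cycle b b"
    unfolding weighted_cycle_def cnj_sum by (intro sum.cong) auto
  with True show ?thesis by simp
next
  case False
  let ?A = "\<lambda>b e. {F. tree_edges F \<and> b \<notin> F \<and> fundamental_cycle F b e \<noteq> 0}"
  have restrict: "weighted_cycle b e = (\<Sum>F\<in>?A b e. tree_weight F * fundamental_cycle F b e)" for b e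
    unfolding weighted_cycle_def
    by (rule sum.mono_neutral_right) (auto simp: finite_tree_edges fundamental_cycle_in)
  have e_in: "e \<in> F" if "F \<in> ?A b e" "b \<in> arcs G" "b \<noteq> e" for F b e
    using that fundamental_cycle_not_in(3)[of F b e] by auto
  have swap: "insert b (F - {e}) \<in> ?A e b" "insert e (insert b (F - {e}) - {b}) = F"
    if F: "F \<in> ?A b e" and be: "b \<in> arcs G" "b \<noteq> e" for F b e
  proof -
    have F': "tree_edges F" "b \<notin> F" "fundamental_cycle F b e \<noteq> 0" using F by auto
    note eF = e_in[OF F be]
    note ex = exchange[OF F'(1) be(1) F'(2) eF F'(3)]
    have "fundamental_cycle (insert b (F - {e})) e b \<noteq> 0"
      using ex(2)[of b] fundamental_cycle_not_in(2)[OF F'(1) be(1) F'(2)] F'(3) by simp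
    then show "insert b (F - {e}) \<in> ?A e b" using ex(1) be(2) by auto
    show "insert e (insert b (F - {e}) - {b}) = F" using eF F'(2) be(2) by auto
  qed
  have "(\<Sum>F\<in>?A b e. complex_of_real (r e) * (tree_weight F * fundamental_cycle F b e))
      = (\<Sum>F\<in>?A e b. complex_of_real (r b) * cnj (tree_weight F * fundamental_cycle F e b))"
  proof (rule sum.reindex_bij_witness[where i="\<lambda>F. insert e (F - {b})" and j="\<lambda>F. insert b (F - {e})"])
    fix F assume F: "F \<in> ?A b e"
    show "insert e (insert b (F - {e}) - {b}) = F" "insert b (F - {e}) \<in> ?A e b"
      using swap[OF F b False] by blast+
    show "complex_of_real (r b) * cnj (tree_weight (insert b (F - {e})) * fundamental_cycle (insert b (F - {e})) e b)
        = complex_of_real (r e) * (tree_weight F * fundamental_cycle F b e)"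
      using F e_in[OF F b False] by (intro exchange_weight[symmetric] b) auto
  next
    fix F assume F: "F \<in> ?A e b"
    show "insert b (insert e (F - {b}) - {e}) = F" "insert e (F - {b}) \<in> ?A b e"
      using swap[OF F e False[symmetric]] by blast+
  qed
  then show ?thesis
    unfolding restrict sum_distrib_left cnj_sum .
qed

lemma weighted_cycle_Z1: "b \<in> arcs G \<Longrightarrow> weighted_cycle b \<in> Z1 G \<rho>"
  using Z1_sum[of "{F. tree_edges F}" "\<lambda>F. fundamental_cycle F b" tree_weight] fundamental_cycle_Z1
  by (simp add: weighted_cycle_def[abs_def])

lemma cycle_eq_sum_weighted_cycles:
  assumes z: "z \<in> Z1 G \<rho>"
  shows "(\<Sum>b\<in>arcs G. z b * weighted_cycle b e) = total_weight * z e"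
proof -
  have "(\<Sum>b\<in>arcs G. z b * weighted_cycle b e)
      = (\<Sum>F | tree_edges F. tree_weight F * (\<Sum>b\<in>arcs G. z b * fundamental_cycle F b e))"
    unfolding weighted_cycle_def sum_distrib_left by (subst sum.swap) (simp add: mult_ac)
  also have "\<dots> = (\<Sum>F | tree_edges F. tree_weight F * z e)"
    by (intro sum.cong) (simp_all add: cycle_eq_sum_fundamental_cycles[OF _ z])
  finally show ?thesis by (simp add: total_weight_def sum_distrib_right)
qed

lemma chain_inner_cell: "b \<in> arcs G \<Longrightarrow> chain_inner G z (cell b) = z b"
  by (simp add: chain_inner_def cell_def if_distrib[of cnj] if_distrib[of "\<lambda>t. _ * t"] cong: if_cong)

lemma chain_inner_residual:
  "chain_inner G (V - resistance_op r z) y =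
    (\<Sum>e\<in>arcs G. V e * cnj (y e)) - (\<Sum>e\<in>arcs G. complex_of_real (r e) * z e * cnj (y e))"
  by (simp add: chain_inner_def resistance_op_def left_diff_distrib sum_subtractf)

text \<open>
  Pair \<open>V - R z\<close>, which is orthogonal to all cycles, with the weighted cycle of \<open>b\<close>; self-adjointness
  turns \<open>\<langle>R z, P b\<rangle>\<close> into \<open>\<langle>R P z, b\<rangle>\<close>, and \<open>P z = z\<close>. As the formula determines \<open>z\<close>, it also
  gives uniqueness.
\<close>

lemma kirchhoff_solution_formula:
  assumes z: "z \<in> Z1 G \<rho>" "V - resistance_op r z \<in> B1 G \<rho>" and b: "b \<in> arcs G"
  shows "z b = 1 / (total_weight * complex_of_real (r b)) * (\<Sum>e\<in>arcs G. V e * cnj (weighted_cycle b e))"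
proof -
  have "(\<Sum>e\<in>arcs G. V e * cnj (weighted_cycle b e))
      = (\<Sum>e\<in>arcs G. complex_of_real (r e) * z e * cnj (weighted_cycle b e))"
    using z(2) weighted_cycle_Z1[OF b] unfolding B1_def
    by (auto simp: chain_inner_residual)
  also have "\<dots> = (\<Sum>e\<in>arcs G. complex_of_real (r b) * (z e * weighted_cycle e b))"
  proof (rule sum.cong[OF refl])
    fix e assume "e \<in> arcs G"
    then show "complex_of_real (r e) * z e * cnj (weighted_cycle b e)
        = complex_of_real (r b) * (z e * weighted_cycle e b)"
      using weighted_cycle_hermitian[OF _ b, of e] by (simp add: mult_ac)
  qed
  also have "\<dots> = complex_of_real (r b) * (total_weight * z b)"
    by (simp add: sum_distrib_left[symmetric] cycle_eq_sum_weighted_cycles[OF z(1)])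
  finally show ?thesis
    using pos[OF b] total_weight_pos by auto
qed

text \<open>
  The solution is the projection of \<open>R\<^sup>-\<^sup>1 V\<close>.
\<close>

lemma kirchhoff_solution_exists:
  assumes V: "V \<in> C1 G"
  shows "\<exists>z. z \<in> Z1 G \<rho> \<and> V - resistance_op r z \<in> B1 G \<rho>"
proof -
  obtain D where D: "D > 0" "total_weight = complex_of_real D" using total_weight_pos by blast
  define z where "z b = (\<Sum>e\<in>arcs G. V e / (total_weight * complex_of_real (r e)) * weighted_cycle e b)" for b
  have zZ: "z \<in> Z1 G \<rho>"
    unfolding z_def by (rule Z1_sum) (rule weighted_cycle_Z1)
  have "chain_inner G (V - resistance_op r z) y = 0" if y: "y \<in> Z1 G \<rho>" for y
  proof -
    have "complex_of_real (r b) * z b * cnj (y b)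
        = (\<Sum>e\<in>arcs G. V e / total_weight * cnj (y b * weighted_cycle b e))" if b: "b \<in> arcs G" for b
    proof -
      have "complex_of_real (r b) * (V e / (total_weight * complex_of_real (r e)) * weighted_cycle e b)
          = V e / total_weight * cnj (weighted_cycle b e)" if e: "e \<in> arcs G" for e
        using weighted_cycle_hermitian[OF e b] pos[OF e] D by (simp add: field_simps)
      then show ?thesis
        unfolding z_def sum_distrib_left sum_distrib_right by (intro sum.cong) (simp_all add: mult_ac)
    qed
    then have "(\<Sum>b\<in>arcs G. complex_of_real (r b) * z b * cnj (y b))
        = (\<Sum>b\<in>arcs G. \<Sum>e\<in>arcs G. V e / total_weight * cnj (y b * weighted_cycle b e))"
      by (intro sum.cong) auto
    also have "\<dots> = (\<Sum>e\<in>arcs G. V e / total_weight * cnj (\<Sum>b\<in>arcs G. y b * weighted_cycle b e))"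
      by (subst sum.swap) (simp add: sum_distrib_left)
    also have "\<dots> = (\<Sum>e\<in>arcs G. V e * cnj (y e))"
      using D by (simp add: cycle_eq_sum_weighted_cycles[OF y])
    finally show ?thesis by (simp add: chain_inner_residual)
  qed
  moreover have "V - resistance_op r z \<in> C1 G"
    using V zZ by (auto simp: C1_def Z1_def resistance_op_def)
  ultimately show ?thesis using zZ by (auto simp: B1_def)
qed

end

theorem corollary2:
  fixes G :: "('v, 'e) pre_digraph"
    and \<rho> :: "'e \<Rightarrow> complex"
    and r :: "'e \<Rightarrow> real"
    and V :: "'e \<Rightarrow> complex"
    and \<Delta> :: complex
  assumes "fin_digraph G"
    and "Digraph_Component.connected G"
    and "line_bundle G \<rho>"
    and "H0_vanishes G \<rho>"
    and "\<forall>b \<in> arcs G. r b > 0"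
    and "V \<in> C1 G"
    and "\<Delta> = (\<Sum>T | rho_spanning_tree G \<rho> T. weight \<rho> r T)"
  shows "(\<exists>!z. z \<in> Z1 G \<rho> \<and> V - resistance_op r z \<in> B1 G \<rho>) \<and>
    \<Delta> \<noteq> 0 \<and>
    (\<forall>z. z \<in> Z1 G \<rho> \<and> V - resistance_op r z \<in> B1 G \<rho> \<longrightarrow>
      (\<forall>b \<in> arcs G.
        chain_inner G z (cell b) =
          1 / \<Delta> * (\<Sum>T | rho_spanning_tree G \<rho> T.
            weight \<rho> r T / complex_of_real (r b) * chain_inner G V (Tbar G \<rho> T (cell b)))))"
proof -
  interpret fin_digraph G by fact
  interpret resistor_network G \<rho> r
    using assms(3-5) by unfold_locales (auto simp: line_bundle_def)
  have sum_trees: "(\<Sum>T | rho_spanning_tree G \<rho> T. f T) = (\<Sum>F | tree_edges F. f (edge_subgraph F))"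
    for f :: "('v, 'e) pre_digraph \<Rightarrow> complex"
  proof (rule sum.reindex_bij_betw[symmetric])
    have "inj_on edge_subgraph {F. tree_edges F}"
      by (rule inj_on_inverseI[where g=arcs]) simp
    then show "bij_betw edge_subgraph {F. tree_edges F} {T. rho_spanning_tree G \<rho> T}"
      by (auto simp: bij_betw_def rho_spanning_tree_iff)
  qed
  have \<Delta>: "\<Delta> = total_weight"
    unfolding assms(7) sum_trees total_weight_def ..
  have Tbar: "Tbar G \<rho> (edge_subgraph F) (cell b) = fundamental_cycle F b" if "b \<in> arcs G" for F b
    using that by (simp add: Tbar_def fundamental_cycle_def fun_eq_iff cell_def if_distrib[of "\<lambda>t. t * _"] cong: if_cong)
  have formula: "(\<Sum>T | rho_spanning_tree G \<rho> T.
      weight \<rho> r T / complex_of_real (r b) * chain_inner G V (Tbar G \<rho> T (cell b)))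
    = 1 / complex_of_real (r b) * (\<Sum>e\<in>arcs G. V e * cnj (weighted_cycle b e))" if b: "b \<in> arcs G" for b
  proof -
    have "(\<Sum>e\<in>arcs G. V e * cnj (weighted_cycle b e))
        = (\<Sum>e\<in>arcs G. \<Sum>F | tree_edges F. tree_weight F * (V e * cnj (fundamental_cycle F b e)))"
      unfolding weighted_cycle_def cnj_sum sum_distrib_left
      by (intro sum.cong refl) (simp add: cnj_tree_weight mult_ac)
    also have "\<dots> = (\<Sum>F | tree_edges F. tree_weight F * chain_inner G V (fundamental_cycle F b))"
      by (subst sum.swap) (simp add: chain_inner_def sum_distrib_left)
    finally show ?thesis
      unfolding sum_trees Tbar[OF b] by (simp add: sum_distrib_left)
  qed
  have solution: "chain_inner G z (cell b) = 1 / \<Delta> * (\<Sum>T | rho_spanning_tree G \<rho> T.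
      weight \<rho> r T / complex_of_real (r b) * chain_inner G V (Tbar G \<rho> T (cell b)))"
    if "z \<in> Z1 G \<rho>" "V - resistance_op r z \<in> B1 G \<rho>" "b \<in> arcs G" for z b
    unfolding chain_inner_cell[OF that(3)] formula[OF that(3)] \<Delta> kirchhoff_solution_formula[OF that]
    by simp
  have unique: "y = z" if y: "y \<in> Z1 G \<rho>" "V - resistance_op r y \<in> B1 G \<rho>"
    and z: "z \<in> Z1 G \<rho>" "V - resistance_op r z \<in> B1 G \<rho>" for y z
  proof
    fix b
    show "y b = z b"
    proof (cases "b \<in> arcs G")
      case True
      then show ?thesis
        using kirchhoff_solution_formula[OF y] kirchhoff_solution_formula[OF z] by simp
    qed (use y(1) z(1) in \<open>simp add: Z1_def C1_def\<close>)
  qed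
  have "\<Delta> \<noteq> 0" using total_weight_pos \<Delta> by auto
  moreover have "\<exists>!z. z \<in> Z1 G \<rho> \<and> V - resistance_op r z \<in> B1 G \<rho>"
    using kirchhoff_solution_exists[OF assms(6)] unique by (intro ex_ex1I) auto
  ultimately show ?thesis using solution by blast
qed

end
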